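(* Let $r,k,n$ be integers with $r\ge 3$, $r\le k\le 2r-1$ and $$n\ge (2r-k-1)\left(\mathrm{e}\,r^4k^{\frac{k}{2}}\right)^{\frac{k}{2k-2r+1}}+k .$$ Let $G$ be a $2K_r$-free graph on $n$ vertices. Then $$\mu_k(G)\le \mu_k\bigl(K_{2k-2r+1}\vee T_{2r-k-1}(n-2k+2r-1)\bigr).$$ Moreover: (i) for $k=2r-1$, equality holds if and only if $|C_k(G)|=1$; (ii) for $r\le k\le 2r-2$, equality holds if and only if $G\cong K_{2k-2r+1}\vee T_{2r-k-1}(n-2k+2r-1)$.
   Context: All graphs are finite, undirected and simple. $\mathrm{e}$ is the base of the natural logarithm. $2K_r$ is the disjoint union of two copies of the complete graph $K_r$. A graph is $F$-free if it does not contain $F$ as a (not necessarily induced) subgraph. $G\vee H$ is the join: the disjoint union of $G$ and $H$ together with all edges between $V(G)$ and $V(H)$. $T_s(m)$ is the complete $s$-partite graph on $m$ vertices in which no two part sizes differ by more than one ($T_1(m)$ is the edgeless graph on $m$ vertices). When $k=2r-1$ the index of $T_{2r-k-1}$ is $0$; then $T_0$ is taken to be the graph with no vertices, so the right-hand side is $\mu_{2r-1}(K_{2r-1})$. An $s$-clique of $G$ is an $s$-element subset of $V(G)$ inducing a complete graph, and $C_s(G)$ is the set of all $s$-cliques of $G$. For $s\ge2$ and $G$ with vertex set $\{1,\dots,n\}$, the $s$-clique tensor $\mathcal{A}_s(G)=(a_{i_1\cdots i_s})$ is the order-$s$ dimension-$n$ tensor with $a_{i_1\cdots i_s}=\frac{1}{(s-1)!}$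 if $\{i_1,\dots,i_s\}\in C_s(G)$ and $0$ otherwise. For an order-$s$ dimension-$n$ tensor $\mathcal{A}=(a_{i_1\cdots i_s})$, a complex number $\lambda$ is an eigenvalue if there is a nonzero $x\in\mathbb{C}^n$ with $\sum_{i_2,\dots,i_s=1}^n a_{i i_2\cdots i_s}x_{i_2}\cdots x_{i_s}=\lambda x_i^{s-1}$ for all $i$; the spectral radius of $\mathcal{A}$ is the maximum modulus of its eigenvalues. The $s$-clique spectral radius $\mu_s(G)$ is the spectral radius of $\mathcal{A}_s(G)$. *)

theory Defs
  imports Complex_Main
begin

datatype 'a graph = Graph (verts: "'a set") (edges: "'a set set")

definition simple_graph :: "'a graph \<Rightarrow> bool" where
  "simple_graph G \<longleftrightarrow> finite (verts G) \<and> (\<forall>e\<in>edges G. e \<subseteq> verts G \<and> card e = 2)"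

definition graph_iso :: "'a graph \<Rightarrow> 'b graph \<Rightarrow> bool" where
  "graph_iso G H \<longleftrightarrow> (\<exists>f. bij_betw f (verts G) (verts H) \<and>
     (\<forall>u\<in>verts G. \<forall>v\<in>verts G. {u, v} \<in> edges G \<longleftrightarrow> {f u, f v} \<in> edges H))"

text \<open>Not necessarily induced copies of \<open>F\<close> in \<open>G\<close>.\<close>

definition contains_subgraph :: "'a graph \<Rightarrow> 'b graph \<Rightarrow> bool" where
  "contains_subgraph G F \<longleftrightarrow> (\<exists>f. inj_on f (verts F) \<and> f ` verts F \<subseteq> verts G \<and>
     (\<forall>e\<in>edges F. f ` e \<in> edges G))"

definition free_of :: "'b graph \<Rightarrow> 'a graph \<Rightarrow> bool" where
  "free_of F G \<longleftrightarrow> \<not> contains_subgraph G F"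

definition complete_graph :: "nat \<Rightarrow> nat graph" where
  "complete_graph n = Graph {..<n} {{u, v} |u v. u < n \<and> v < n \<and> u \<noteq> v}"

definition disjoint_union :: "'a graph \<Rightarrow> 'b graph \<Rightarrow> ('a + 'b) graph" where
  "disjoint_union G H = Graph (verts G <+> verts H)
     ((\<lambda>e. Inl ` e) ` edges G \<union> (\<lambda>e. Inr ` e) ` edges H)"

definition graph_join :: "'a graph \<Rightarrow> 'b graph \<Rightarrow> ('a + 'b) graph" where
  "graph_join G H = Graph (verts (disjoint_union G H))
     (edges (disjoint_union G H) \<union> {{Inl u, Inr v} |u v. u \<in> verts G \<and> v \<in> verts H})"

text \<open>
  The parts of \<open>turan_graph s m\<close> are the residue classes modulo \<open>s\<close> of the numbers below \<open>m\<close>;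
  their sizes are balanced, see \<open>turan_graph_parts\<close>.  By convention, \<open>turan_graph 0 m\<close> is the
  graph with no vertices, whatever \<open>m\<close> is.
\<close>

definition turan_graph :: "nat \<Rightarrow> nat \<Rightarrow> nat graph" where
  "turan_graph s m = (if s = 0 then Graph {} {}
     else Graph {..<m} {{u, v} |u v. u < m \<and> v < m \<and> u mod s \<noteq> v mod s})"

lemma turan_graph_parts:
  fixes i j s m :: nat
  assumes "i < s" "j < s"
  shows "card {v. v < m \<and> v mod s = i} \<le> card {v. v < m \<and> v mod s = j} + 1"
proof -
  let ?P = "\<lambda>j. {v. v < m \<and> v mod s = j}"
  have f: "finite (?P l)" for l by (rule finite_subset[of _ "{..<m}"]) auto
  let ?g = "\<lambda>v. (v div s - 1) * s + j"
  have "?g ` (?P i - {i}) \<subseteq> ?P j"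
  proof
    fix w assume "w \<in> ?g ` (?P i - {i})"
    then obtain v where v: "v < m" "v mod s = i" "v \<noteq> i" "w = ?g v" by blast
    have e: "v = v div s * s + i" using v(2) by (metis div_mult_mod_eq)
    with v(3) have "v div s \<noteq> 0" by (metis add_0 mult_0)
    then have "v div s * s = (v div s - 1) * s + s"
      by (metis Suc_pred' add.commute mult_Suc neq0_conv)
    with e v assms(2) have "w < m" by linarith
    with v(4) assms(2) show "w \<in> ?P j" by simp
  qed
  moreover have "inj_on ?g (?P i - {i})"
  proof (rule inj_onI)
    fix u v assume u: "u \<in> ?P i - {i}" and v: "v \<in> ?P i - {i}" and eq: "?g u = ?g v"
    have eu: "u = u div s * s + i" using u by (metis (mono_tags) DiffD1 div_mult_mod_eq mem_Collect_eq)
    have ev: "v = v div s * s + i" using v by (metis (mono_tags) DiffD1 div_mult_mod_eq mem_Collect_eq)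
    have "u div s \<noteq> 0" using eu u by (metis DiffD2 add_0 insertI1 mult_0)
    moreover have "v div s \<noteq> 0" using ev v by (metis DiffD2 add_0 insertI1 mult_0)
    moreover have "u div s - 1 = v div s - 1" using eq assms by simp
    ultimately have "u div s = v div s" by linarith
    with eu ev show "u = v" by simp
  qed
  ultimately have "card (?P i - {i}) \<le> card (?P j)" using f card_inj_on_le by blast
  moreover have "card (?P i) \<le> card (?P i - {i}) + 1"
    by (metis (no_types, lifting) card_Diff1_le card_Diff_singleton_if diff_le_self le_diff_conv order_refl trans_le_add1)
  ultimately show ?thesis by linarith
qed

definition cliques :: "nat \<Rightarrow> 'a graph \<Rightarrow> 'a set set" where
  "cliques s G = {S. S \<subseteq> verts G \<and> finite S \<and> card S = s \<and>
     (\<forall>u\<in>S. \<forall>v\<in>S. u \<noteq> v \<longrightarrow> {u, v} \<in> edges G)}"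

text \<open>
  A tensor of order \<open>s\<close> whose indices range over a finite set \<open>V\<close> (of cardinality the dimension)
  is given by its entries at the lists of length \<open>s\<close> over \<open>V\<close>; other lists are irrelevant.
  Indexing by \<open>V\<close> instead of \<open>{1..n}\<close> makes the adjacency tensor of a graph independent of
  a numbering of its vertices.
\<close>

type_synonym 'a tensor = "'a list \<Rightarrow> complex"

definition tensor_eigenvalue :: "nat \<Rightarrow> 'a set \<Rightarrow> 'a tensor \<Rightarrow> complex \<Rightarrow> bool" where
  "tensor_eigenvalue s V A ev \<longleftrightarrow> (\<exists>x. (\<exists>i\<in>V. x i \<noteq> 0) \<and>
     (\<forall>i\<in>V. (\<Sum>is | set is \<subseteq> V \<and> length is = s - 1. A (i # is) * prod_list (map x is))
              = ev * x i ^ (s - 1)))"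

text \<open>
  For finite nonempty \<open>V\<close> and \<open>s \<ge> 2\<close> the set of eigenvalues is compact and nonempty, so the
  supremum is the maximum modulus of the eigenvalues.
\<close>

definition tensor_spectral_radius :: "nat \<Rightarrow> 'a set \<Rightarrow> 'a tensor \<Rightarrow> real" where
  "tensor_spectral_radius s V A = Sup {cmod ev |ev. tensor_eigenvalue s V A ev}"

definition clique_tensor :: "nat \<Rightarrow> 'a graph \<Rightarrow> 'a tensor" where
  "clique_tensor s G = (\<lambda>is. if set is \<in> cliques s G then 1 / fact (s - 1) else 0)"

definition clique_spectral_radius :: "nat \<Rightarrow> 'a graph \<Rightarrow> real" where
  "clique_spectral_radius s G = tensor_spectral_radius s (verts G) (clique_tensor s G)"

end

theory Submission
  imports Defs "HOL-Analysis.Analysis" "HOL-Combinatorics.Multiset_Permutations"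
begin

text \<open>
  Put \<open>a = 2k - 2r + 1\<close> and \<open>s = 2r - k - 1\<close>, so that \<open>k = a + s\<close>. The proof turns the spectral
  problem into a problem of counting \<open>k\<close>-cliques.

  The clique spectral radius is the maximum of \<open>k\<close> times \<open>L x = (\<Sum>K. \<Prod>v\<in>K. x v)\<close>, where \<open>K\<close> ranges over
  the \<open>k\<close>-cliques and \<open>x\<close> over the nonnegative vectors with \<open>\<Sum>v. x v ^ k = 1\<close>
  (\<open>clique_spectral_radius_variational\<close>). By Hoelder's inequality its \<open>k\<close>-th power is at most
  \<open>k^k N^(k - 1)\<close> times the maximum of \<open>L\<close> on the simplex, where \<open>N\<close> is the number of \<open>k\<close>-cliques.
  That maximum is always at most \<open>e\<close>, and it is at most \<open>k^(-k)\<close> if the graph has no \<open>(k+1)\<close>-clique.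
  The second estimate yields the bound \<open>\<mu>^k \<le> N^(k - 1)\<close>. The extremal graph attains it: its number of
  \<open>k\<close>-cliques is the product \<open>P\<close> of the part sizes of the Turan graph, and an explicit test vector
  gives \<open>\<mu>^k \<ge> P^(k - 1)\<close> (\<open>clique_spectral_radius_core_turan_ge\<close>).

  In a \<open>2K_r\<close>-free graph two \<open>k\<close>-cliques meet in at least \<open>a\<close> vertices, since otherwise their union
  contains two disjoint copies of \<open>K_r\<close> (\<open>cliques_intersect\<close>).

  Suppose that all \<open>k\<close>-cliques contain a common set of \<open>a\<close> vertices. Then there is no \<open>(k+1)\<close>-clique, and
  \<open>N\<close> is the number of \<open>s\<close>-cliques of the common neighbourhood of that set, which has no
  \<open>(s+1)\<close>-clique. The clique version of Turan's theorem gives \<open>N \<le> P\<close>, with equality only for the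
  extremal graph (\<open>card_cliques_with_core\<close>).

  Suppose that there is no such set. Then \<open>N\<close> is of order at most \<open>n^(s - 1)\<close>
  (\<open>card_intersecting_family_le\<close>), whereas \<open>P\<close> is of order \<open>n^s\<close>; the lower bound on \<open>n\<close> makes this
  loss larger than all constants, including \<open>e k^k\<close>, so the inequality is strict
  (\<open>clique_spectral_radius_less_without_core\<close>).

  For \<open>s = 0\<close> there is at most one \<open>k\<close>-clique, and the radius is \<open>1\<close> or \<open>0\<close> according to whether it
  exists.
\<close>

section \<open>The clique spectral radius as a constrained maximum\<close>

text \<open>\<open>k\<close> times this polynomial is the homogeneous form of the clique tensor.\<close>

definition clique_poly :: "nat \<Rightarrow> 'a graph \<Rightarrow> ('a \<Rightarrow> real) \<Rightarrow> real" where
  "clique_poly k G x = (\<Sum>K\<in>cliques k G. \<Prod>v\<in>K. x v)"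

lemma finite_cliques: "finite (verts G) \<Longrightarrow> finite (cliques s G)"
  by (rule finite_subset[of _ "Pow (verts G)"]) (auto simp: cliques_def)

lemma cliquesD:
  assumes "K \<in> cliques s G"
  shows "K \<subseteq> verts G" "finite K" "card K = s"
    "\<And>u v. u \<in> K \<Longrightarrow> v \<in> K \<Longrightarrow> u \<noteq> v \<Longrightarrow> {u, v} \<in> edges G"
  using assms by (auto simp: cliques_def)

text \<open>A nonzero tensor entry at \<open>i # is\<close> forces \<open>i # is\<close> to enumerate a clique \<open>K\<close> without repetition,
  and the \<open>(k - 1)!\<close> enumerations of \<open>K - {i}\<close> cancel the normalising factor.\<close>

lemma clique_tensor_sum:
  fixes x :: "'a \<Rightarrow> complex"
  assumes fin: "finite (verts G)" and k: "k \<ge> 1"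
  shows "(\<Sum>is | set is \<subseteq> verts G \<and> length is = k - 1. clique_tensor k G (i # is) * prod_list (map x is))
       = (\<Sum>K | K \<in> cliques k G \<and> i \<in> K. \<Prod>v\<in>K - {i}. x v)"
proof -
  let ?C = "{K. K \<in> cliques k G \<and> i \<in> K}"
  let ?f = "\<lambda>is. clique_tensor k G (i # is) * prod_list (map x is)"
  let ?J = "\<Union>K\<in>?C. permutations_of_set (K - {i})"
  have J: "set is \<subseteq> verts G \<and> length is = k - 1" if "is": "is \<in> ?J" for "is"
  proof -
    obtain K where K: "K \<in> cliques k G" "i \<in> K" "is \<in> permutations_of_set (K - {i})"
      using "is" by blast
    then have "set is = K - {i}" "distinct is" by (auto dest: permutations_of_setD)
    then show ?thesis using cliquesD(1,2,3)[OF K(1)] K(2) distinct_card[of "is"] by auto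
  qed
  have zero: "?f is = 0" if "set is \<subseteq> verts G" "length is = k - 1" "is \<notin> ?J" for "is"
  proof (cases "set (i # is) \<in> cliques k G")
    case True
    then have "card (set (i # is)) = length (i # is)" using that(2) k cliquesD(3) by fastforce
    then have "distinct (i # is)" by (rule card_distinct)
    then have "is \<in> permutations_of_set (set (i # is) - {i})"
      by (intro permutations_of_setI) auto
    with True that(3) show ?thesis by auto
  qed (simp add: clique_tensor_def)
  have "(\<Sum>is | set is \<subseteq> verts G \<and> length is = k - 1. ?f is) = sum ?f ?J"
    by (rule sum.mono_neutral_right) (use J zero finite_lists_length_eq[OF fin] in auto)
  also have "\<dots> = (\<Sum>K\<in>?C. \<Sum>is\<in>permutations_of_set (K - {i}). ?f is)"
  proof (rule sum.UNION_disjoint)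
    show "finite ?C" using finite_cliques[OF fin] by simp
    show "\<forall>K\<in>?C. \<forall>L\<in>?C. K \<noteq> L \<longrightarrow>
        permutations_of_set (K - {i}) \<inter> permutations_of_set (L - {i}) = {}"
    proof (intro ballI impI equals0I)
      fix K L js assume *: "K \<in> ?C" "L \<in> ?C" "K \<noteq> L"
        "js \<in> permutations_of_set (K - {i}) \<inter> permutations_of_set (L - {i})"
      then have "K - {i} = L - {i}" by (auto dest: permutations_of_setD)
      with * show False by (metis (mono_tags, lifting) insert_Diff mem_Collect_eq)
    qed
  qed auto
  also have "\<dots> = (\<Sum>K\<in>?C. \<Prod>v\<in>K - {i}. x v)"
  proof (rule sum.cong[OF refl])
    fix K assume K: "K \<in> ?C"
    then have fK: "finite K" "card K = k" by (auto dest: cliquesD)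
    have "?f is = (1 / fact (k - 1)) * (\<Prod>v\<in>K - {i}. x v)" if "is \<in> permutations_of_set (K - {i})" for "is"
    proof -
      have s: "set is = K - {i}" "distinct is" using that by (auto dest: permutations_of_setD)
      then have "set (i # is) = K" using K by auto
      with s K show ?thesis
        by (simp add: clique_tensor_def prod.distinct_set_conv_list[symmetric])
    qed
    then have "(\<Sum>is\<in>permutations_of_set (K - {i}). ?f is)
        = of_nat (card (permutations_of_set (K - {i}))) * ((1 / fact (k - 1)) * (\<Prod>v\<in>K - {i}. x v))"
      by simp
    also have "card (permutations_of_set (K - {i})) = fact (k - 1)" using fK K by simp
    finally show "(\<Sum>is\<in>permutations_of_set (K - {i}). ?f is) = (\<Prod>v\<in>K - {i}. x v)" by simp
  qed
  finally show ?thesis .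
qed

lemma clique_poly_mono:
  assumes "finite (verts G)" "\<And>v. v \<in> verts G \<Longrightarrow> 0 \<le> x v" "C \<subseteq> cliques k G"
  shows "(\<Sum>K\<in>C. \<Prod>v\<in>K. x v) \<le> clique_poly k G x"
  unfolding clique_poly_def
  by (rule sum_mono2) (use assms in \<open>auto intro!: finite_cliques prod_nonneg dest: cliquesD(1)\<close>)

lemma clique_poly_nonneg:
  assumes "\<And>v. v \<in> verts G \<Longrightarrow> 0 \<le> x v"
  shows "0 \<le> clique_poly k G x"
  unfolding clique_poly_def by (intro sum_nonneg prod_nonneg) (use assms cliquesD(1) in blast)

lemma clique_poly_cong:
  assumes "\<And>v. v \<in> verts G \<Longrightarrow> x v = y v"
  shows "clique_poly k G x = clique_poly k G y"
  unfolding clique_poly_def by (intro sum.cong prod.cong refl) (use assms cliquesD(1) in blast)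

lemma clique_poly_scale: "clique_poly k G (\<lambda>v. c * x v) = c ^ k * clique_poly k G x"
  unfolding clique_poly_def sum_distrib_left
  by (intro sum.cong refl) (simp add: prod.distrib cliquesD(3))

text \<open>Euler's identity for the homogeneous polynomial \<open>clique_poly k G\<close>.\<close>

lemma clique_poly_euler:
  fixes x :: "'a \<Rightarrow> real"
  assumes fin: "finite (verts G)"
  shows "(\<Sum>i\<in>verts G. x i * (\<Sum>K | K \<in> cliques k G \<and> i \<in> K. \<Prod>v\<in>K - {i}. x v)) = k * clique_poly k G x"
proof -
  have "(\<Sum>i\<in>verts G. x i * (\<Sum>K | K \<in> cliques k G \<and> i \<in> K. \<Prod>v\<in>K - {i}. x v))
      = (\<Sum>i\<in>verts G. \<Sum>K | K \<in> cliques k G \<and> i \<in> K. \<Prod>v\<in>K. x v)"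
    unfolding sum_distrib_left
    by (intro sum.cong refl) (auto simp: prod.remove dest: cliquesD)
  also have "\<dots> = (\<Sum>K\<in>cliques k G. \<Sum>i | i \<in> verts G \<and> i \<in> K. \<Prod>v\<in>K. x v)"
    by (rule sum.swap_restrict[OF fin finite_cliques[OF fin]])
  also have "\<dots> = (\<Sum>K\<in>cliques k G. real k * (\<Prod>v\<in>K. x v))"
  proof (rule sum.cong[OF refl])
    fix K assume K: "K \<in> cliques k G"
    then have "{i. i \<in> verts G \<and> i \<in> K} = K" by (auto dest: cliquesD)
    then show "(\<Sum>i | i \<in> verts G \<and> i \<in> K. \<Prod>v\<in>K. x v) = real k * (\<Prod>v\<in>K. x v)"
      using cliquesD(3)[OF K] by simp
  qed
  finally show ?thesis by (simp add: clique_poly_def sum_distrib_left)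
qed

text \<open>No clique uses a vertex twice, so the form is affine in each single coordinate.\<close>

lemma clique_poly_fun_upd:
  fixes x :: "'a \<Rightarrow> real"
  assumes fin: "finite (verts G)"
  shows "clique_poly k G (x(i := t)) = t * (\<Sum>K | K \<in> cliques k G \<and> i \<in> K. \<Prod>v\<in>K - {i}. x v)
     + (\<Sum>K | K \<in> cliques k G \<and> i \<notin> K. \<Prod>v\<in>K. x v)"
proof -
  let ?y = "x(i := t)"
  have "clique_poly k G ?y = (\<Sum>K | K \<in> cliques k G \<and> i \<in> K. \<Prod>v\<in>K. ?y v)
      + (\<Sum>K | K \<in> cliques k G \<and> i \<notin> K. \<Prod>v\<in>K. ?y v)"
    unfolding clique_poly_def using sum.Int_Diff[OF finite_cliques[OF fin], of "\<lambda>K. \<Prod>v\<in>K. ?y v" k "{K. i \<in> K}"]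
    by (simp add: Int_def set_diff_eq)
  also have "(\<Sum>K | K \<in> cliques k G \<and> i \<in> K. \<Prod>v\<in>K. ?y v)
      = t * (\<Sum>K | K \<in> cliques k G \<and> i \<in> K. \<Prod>v\<in>K - {i}. x v)"
    unfolding sum_distrib_left
  proof (intro sum.cong refl)
    fix K assume "K \<in> {K. K \<in> cliques k G \<and> i \<in> K}"
    then have "(\<Prod>v\<in>K. ?y v) = ?y i * (\<Prod>v\<in>K - {i}. ?y v)"
      by (intro prod.remove) (auto dest: cliquesD)
    also have "(\<Prod>v\<in>K - {i}. ?y v) = (\<Prod>v\<in>K - {i}. x v)" by (intro prod.cong) auto
    finally show "(\<Prod>v\<in>K. ?y v) = t * (\<Prod>v\<in>K - {i}. x v)" by simp
  qed
  also have "(\<Sum>K | K \<in> cliques k G \<and> i \<notin> K. \<Prod>v\<in>K. ?y v)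
      = (\<Sum>K | K \<in> cliques k G \<and> i \<notin> K. \<Prod>v\<in>K. x v)"
    by (intro sum.cong prod.cong) auto
  finally show ?thesis .
qed

text \<open>The unit sphere of the \<open>k\<close>-norm in the nonnegative orthant is compact, so the form attains
  its maximum there; homogeneity turns this into an inequality for all nonnegative vectors.\<close>

lemma clique_poly_maximiser:
  assumes fin: "finite (verts G)" and ne: "verts G \<noteq> {}" and k: "k \<ge> 2"
  obtains x M where "\<And>v. 0 \<le> x v" "(\<Sum>v\<in>verts G. x v ^ k) = 1" "M = k * clique_poly k G x"
    "\<And>y. (\<And>v. v \<in> verts G \<Longrightarrow> 0 \<le> y v) \<Longrightarrow> k * clique_poly k G y \<le> M * (\<Sum>v\<in>verts G. y v ^ k)"
proof -
  let ?V = "verts G"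
  define B where "B = (PiE UNIV (\<lambda>v. if v \<in> ?V then {0..1} else {0::real}))"
  have "compact B"
    using compactin_PiE[of "\<lambda>_. euclidean" UNIV "\<lambda>v. if v \<in> ?V then {0..1} else {0::real}"]
    by (auto simp: B_def euclidean_product_topology)
  moreover have "closed {x. (\<Sum>v\<in>?V. x v ^ k) = (1::real)}"
    by (intro closed_Collect_eq continuous_intros continuous_on_product_coordinates)
  ultimately have comp: "compact (B \<inter> {x. (\<Sum>v\<in>?V. x v ^ k) = 1})" by (rule compact_Int_closed)
  obtain v0 where v0: "v0 \<in> ?V" using ne by blast
  have "(\<Sum>v\<in>?V. (if v = v0 then 1 else 0::real) ^ k) = (\<Sum>v\<in>?V. if v = v0 then 1 else 0)"
    by (intro sum.cong) (use k in auto)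
  also have "\<dots> = 1" using v0 fin by simp
  finally have "(\<lambda>v. if v = v0 then 1 else 0) \<in> B \<inter> {x. (\<Sum>v\<in>?V. x v ^ k) = 1}"
    using v0 by (auto simp: B_def)
  then have nonempty: "B \<inter> {x. (\<Sum>v\<in>?V. x v ^ k) = 1} \<noteq> {}" by blast
  have "continuous_on (B \<inter> {x. (\<Sum>v\<in>?V. x v ^ k) = 1}) (\<lambda>x. k * clique_poly k G x)"
    unfolding clique_poly_def
    by (intro continuous_intros continuous_on_subset[OF continuous_on_product_coordinates]) auto
  from continuous_attains_sup[OF comp nonempty this]
  obtain x where x: "x \<in> B" "(\<Sum>v\<in>?V. x v ^ k) = 1"
    and max: "\<And>y. y \<in> B \<Longrightarrow> (\<Sum>v\<in>?V. y v ^ k) = 1 \<Longrightarrow> k * clique_poly k G y \<le> k * clique_poly k G x"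
    by auto
  have "k * clique_poly k G y \<le> (k * clique_poly k G x) * (\<Sum>v\<in>?V. y v ^ k)"
    if y: "\<And>v. v \<in> ?V \<Longrightarrow> 0 \<le> y v" for y
  proof (cases "(\<Sum>v\<in>?V. y v ^ k) = 0")
    case True
    then have "\<forall>v\<in>?V. y v ^ k = 0" using y by (subst (asm) sum_nonneg_eq_0_iff) (auto simp: fin)
    then have 0: "y v = 0" if "v \<in> ?V" for v using that by simp
    have "clique_poly k G y = 0"
      unfolding clique_poly_def
    proof (rule sum.neutral, rule ballI)
      fix K assume K: "K \<in> cliques k G"
      with k obtain v where "v \<in> K" by (metis cliquesD(3) card.empty ex_in_conv not_numeral_le_zero)
      with K 0 show "(\<Prod>v\<in>K. y v) = 0" by (auto intro!: prod_zero dest: cliquesD)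
    qed
    with True show ?thesis by simp
  next
    case False
    define N where "N = (\<Sum>v\<in>?V. y v ^ k)"
    have N: "N > 0" using False y by (simp add: N_def order_less_le sum_nonneg)
    define t where "t = root k N"
    have t: "t > 0" "t ^ k = N" using N k by (auto simp: t_def)
    define z where "z = (\<lambda>v. if v \<in> ?V then y v / t else 0)"
    have sz: "(\<Sum>v\<in>?V. z v ^ k) = 1"
      using t N by (simp add: z_def power_divide sum_divide_distrib[symmetric] N_def[symmetric])
    have "z v \<le> 1" if "v \<in> ?V" for v
    proof -
      have "z v ^ k \<le> (\<Sum>v\<in>?V. z v ^ k)"
        by (rule member_le_sum) (use that y t fin in \<open>auto simp: z_def\<close>)
      then have "z v ^ k \<le> 1 ^ k" using sz by simp
      then show ?thesis using k y t that by (subst (asm) power_mono_iff) (auto simp: z_def)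
    qed
    then have "z \<in> B" using y t by (auto simp: B_def z_def)
    from max[OF this sz] have "k * clique_poly k G z \<le> k * clique_poly k G x" .
    moreover have "clique_poly k G y = t ^ k * clique_poly k G z"
      unfolding clique_poly_scale[symmetric]
      by (rule clique_poly_cong) (use t in \<open>auto simp: z_def\<close>)
    ultimately have "k * clique_poly k G y = N * (k * clique_poly k G z)"
      "N * (k * clique_poly k G z) \<le> N * (k * clique_poly k G x)"
      using t N by (auto intro: mult_left_mono)
    then show ?thesis unfolding N_def[symmetric] by (simp only: mult.commute[of _ N])
  qed
  moreover have "0 \<le> x v" for v using x(1) by (cases "v \<in> ?V") (auto simp: B_def PiE_iff dest!: spec[of _ v])
  ultimately show thesis using that[of x "k * clique_poly k G x"] x(2) by blast
qed

text \<open>A maximiser is an eigenvector. Moving a single coordinate \<open>t\<close> of it changes \<open>M\<close> times the norm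
  minus the form by a polynomial in \<open>t\<close> that is nonnegative for \<open>t \<ge> 0\<close> and vanishes at the current
  value. At an interior zero the derivative vanishes, which is the eigenvalue equation; at the
  boundary value \<open>0\<close> the linear coefficient cannot be negative, which forces both sides to be \<open>0\<close>.\<close>

lemma maximiser_eigen_equation:
  fixes x :: "'a \<Rightarrow> real"
  assumes fin: "finite (verts G)" and k: "k \<ge> 2" and i: "i \<in> verts G"
    and x: "\<And>v. 0 \<le> x v" "(\<Sum>v\<in>verts G. x v ^ k) = 1" and M: "M = k * clique_poly k G x"
    and max: "\<And>y. (\<And>v. v \<in> verts G \<Longrightarrow> 0 \<le> y v) \<Longrightarrow> k * clique_poly k G y \<le> M * (\<Sum>v\<in>verts G. y v ^ k)"
  shows "(\<Sum>K | K \<in> cliques k G \<and> i \<in> K. \<Prod>v\<in>K - {i}. x v) = M * x i ^ (k - 1)"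
proof -
  define D where "D = (\<Sum>K | K \<in> cliques k G \<and> i \<in> K. \<Prod>v\<in>K - {i}. x v)"
  define E where "E = (\<Sum>K | K \<in> cliques k G \<and> i \<notin> K. \<Prod>v\<in>K. x v)"
  define R where "R = (\<Sum>v\<in>verts G - {i}. x v ^ k)"
  have norm_upd: "(\<Sum>v\<in>verts G. (x(i := t)) v ^ k) = t ^ k + R" for t
    using fin i by (simp add: R_def sum.remove)
  have "(\<Sum>v\<in>verts G. x v ^ k) = x i ^ k + R" using norm_upd[of "x i"] by simp
  then have eq: "M * (x i ^ k + R) - k * (x i * D + E) = 0"
    using clique_poly_fun_upd[OF fin, of k x i "x i"] x(2) M by (simp add: D_def E_def)
  have ge: "0 \<le> M * (t ^ k + R) - k * (t * D + E)" if "t \<ge> 0" for t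
    using max[of "x(i := t)"] x(1) that
    unfolding norm_upd clique_poly_fun_upd[OF fin] D_def[symmetric] E_def[symmetric] by simp
  have M0: "M \<ge> 0" unfolding M by (simp add: clique_poly_nonneg x(1))
  have D0: "D \<ge> 0" unfolding D_def by (intro sum_nonneg prod_nonneg) (auto simp: x(1))
  show ?thesis
  proof (cases "x i = 0")
    case True
    have "D = 0"
    proof (rule ccontr)
      assume "D \<noteq> 0"
      with D0 have D: "D > 0" by simp
      define t where "t = D / (M + D)"
      have t: "0 < t" "t \<le> 1" using D M0 by (auto simp: t_def)
      from k have "k = Suc (k - 1)" by simp
      then have tk: "t ^ k = t * t ^ (k - 1)" by (metis power_Suc)
      have "k * (t * D) \<le> M * t ^ k"
        using ge[of t] eq True t k by (simp add: algebra_simps power_0_left)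
      then have "t * (k * D) \<le> t * (M * t ^ (k - 1))" by (simp add: tk algebra_simps)
      then have "k * D \<le> M * t ^ (k - 1)" using t(1) by simp
      also have "t ^ (k - 1) \<le> t ^ 1" using t k by (intro power_decreasing) auto
      then have "M * t ^ (k - 1) \<le> M * t" using M0 by (simp add: mult_left_mono)
      also have "M * t < D" using D M0 by (simp add: t_def field_simps)
      finally have "k * D < 1 * D" by simp
      with D k show False by (simp only: mult_less_cancel_right) simp
    qed
    with True k show ?thesis by (simp add: D_def)
  next
    case False
    then have pos: "x i > 0" using x(1)[of i] by simp
    let ?g = "\<lambda>t. M * (t ^ k + R) - k * (t * D + E)"
    have "(?g has_real_derivative (M * (k * x i ^ (k - 1)) - k * D)) (at (x i))"
      by (auto intro!: derivative_eq_intros)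
    then have "M * (k * x i ^ (k - 1)) - k * D = 0"
      by (rule DERIV_local_min[where d = "x i"]) (use pos eq ge in auto)
    then have "k * (M * x i ^ (k - 1)) = k * D" by simp
    with k show ?thesis by (simp add: D_def)
  qed
qed

text \<open>Taking moduli in the eigenvalue equation and pairing it with the vector of moduli bounds every
  complex eigenvalue by the maximum of the form, which itself is an eigenvalue.\<close>

lemma clique_spectral_radius_variational:
  assumes fin: "finite (verts G)" and ne: "verts G \<noteq> {}" and k: "k \<ge> 2"
  obtains x where "\<And>v. 0 \<le> x v" "(\<Sum>v\<in>verts G. x v ^ k) = 1"
    "clique_spectral_radius k G = k * clique_poly k G x"
    "\<And>y. (\<And>v. v \<in> verts G \<Longrightarrow> 0 \<le> y v) \<Longrightarrow>
       k * clique_poly k G y \<le> clique_spectral_radius k G * (\<Sum>v\<in>verts G. y v ^ k)"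
proof -
  let ?V = "verts G"
  obtain x M where x: "\<And>v. 0 \<le> x v" "(\<Sum>v\<in>?V. x v ^ k) = 1" and M: "M = k * clique_poly k G x"
    and max: "\<And>y. (\<And>v. v \<in> ?V \<Longrightarrow> 0 \<le> y v) \<Longrightarrow> k * clique_poly k G y \<le> M * (\<Sum>v\<in>?V. y v ^ k)"
    by (rule clique_poly_maximiser[OF assms]) blast
  have M0: "M \<ge> 0" unfolding M by (simp add: clique_poly_nonneg x(1))
  have k1: "k \<ge> 1" using k by simp
  have "clique_spectral_radius k G = M"
    unfolding clique_spectral_radius_def tensor_spectral_radius_def
  proof (rule cSup_eq_maximum)
    have "tensor_eigenvalue k ?V (clique_tensor k G) (of_real M)"
      unfolding tensor_eigenvalue_def clique_tensor_sum[OF fin k1]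
    proof (intro exI[of _ "\<lambda>v. of_real (x v)"] conjI ballI)
      have "\<exists>i\<in>?V. x i \<noteq> 0"
      proof (rule ccontr)
        assume "\<not> (\<exists>i\<in>?V. x i \<noteq> 0)"
        then have "(\<Sum>v\<in>?V. x v ^ k) = 0" using k by (intro sum.neutral) auto
        with x(2) show False by simp
      qed
      then show "\<exists>i\<in>?V. complex_of_real (x i) \<noteq> 0" by simp
    next
      fix i assume i: "i \<in> ?V"
      show "(\<Sum>K | K \<in> cliques k G \<and> i \<in> K. \<Prod>v\<in>K - {i}. complex_of_real (x v))
          = of_real M * of_real (x i) ^ (k - 1)"
        using arg_cong[OF maximiser_eigen_equation[OF fin k i x M max], of complex_of_real] by simp
    qed
    then show "M \<in> {cmod ev |ev. tensor_eigenvalue k ?V (clique_tensor k G) ev}"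
      using M0 by (auto intro!: exI[of _ "of_real M"])
  next
    fix e assume "e \<in> {cmod ev |ev. tensor_eigenvalue k ?V (clique_tensor k G) ev}"
    then obtain ev z where e: "e = cmod ev" and nz: "\<exists>i\<in>?V. z i \<noteq> 0"
      and eig: "\<And>i. i \<in> ?V \<Longrightarrow> (\<Sum>K | K \<in> cliques k G \<and> i \<in> K. \<Prod>v\<in>K - {i}. z v) = ev * z i ^ (k - 1)"
      unfolding tensor_eigenvalue_def clique_tensor_sum[OF fin k1] by blast
    let ?y = "\<lambda>v. cmod (z v)"
    have kS: "k = Suc (k - 1)" using k by simp
    have "e * (\<Sum>i\<in>?V. ?y i ^ k) = (\<Sum>i\<in>?V. ?y i * cmod (ev * z i ^ (k - 1)))"
      unfolding sum_distrib_left
      by (intro sum.cong refl, subst kS, simp add: e norm_mult norm_power)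
    also have "\<dots> = (\<Sum>i\<in>?V. ?y i * cmod (\<Sum>K | K \<in> cliques k G \<and> i \<in> K. \<Prod>v\<in>K - {i}. z v))"
      by (intro sum.cong refl) (simp add: eig)
    also have "\<dots> \<le> (\<Sum>i\<in>?V. ?y i * (\<Sum>K | K \<in> cliques k G \<and> i \<in> K. \<Prod>v\<in>K - {i}. ?y v))"
      by (intro sum_mono mult_left_mono order.trans[OF norm_sum]) (auto simp: prod_norm)
    also have "\<dots> = k * clique_poly k G ?y" by (rule clique_poly_euler[OF fin])
    also have "\<dots> \<le> M * (\<Sum>v\<in>?V. ?y v ^ k)" by (rule max) simp
    finally have le: "e * (\<Sum>i\<in>?V. ?y i ^ k) \<le> M * (\<Sum>i\<in>?V. ?y i ^ k)" .
    obtain i where i: "i \<in> ?V" "z i \<noteq> 0" using nz by blast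
    then have "0 < ?y i ^ k" by simp
    also have "\<dots> \<le> (\<Sum>i\<in>?V. ?y i ^ k)" using i fin by (intro member_le_sum) auto
    finally show "e \<le> M" using le by simp
  qed
  then show thesis using that[of x] x M max by simp
qed

lemma clique_spectral_radius_ge:
  assumes "finite (verts G)" "verts G \<noteq> {}" "k \<ge> 2" "\<And>v. v \<in> verts G \<Longrightarrow> 0 \<le> y v"
  shows "k * clique_poly k G y \<le> clique_spectral_radius k G * (\<Sum>v\<in>verts G. y v ^ k)"
  using clique_spectral_radius_variational[OF assms(1-3)] assms(4) by metis

lemma clique_spectral_radius_nonneg:
  assumes "finite (verts G)" "verts G \<noteq> {}" "k \<ge> 2"
  shows "0 \<le> clique_spectral_radius k G"
proof -
  obtain x where x: "\<And>v. 0 \<le> x v" "clique_spectral_radius k G = k * clique_poly k G x"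
    using clique_spectral_radius_variational[OF assms] by metis
  then show ?thesis by (simp add: clique_poly_nonneg)
qed

lemma clique_spectral_radius_ge_1:
  assumes "finite (verts G)" "k \<ge> 2" "K \<in> cliques k G"
  shows "1 \<le> clique_spectral_radius k G"
proof -
  let ?y = "\<lambda>v. if v \<in> K then 1 else (0::real)"
  have "verts G \<noteq> {}" using cliquesD[OF assms(3)] assms(2) by auto
  then have "k * clique_poly k G ?y \<le> clique_spectral_radius k G * (\<Sum>v\<in>verts G. ?y v ^ k)"
    by (intro clique_spectral_radius_ge assms) auto
  moreover have "(\<Sum>v\<in>verts G. ?y v ^ k) = (\<Sum>v\<in>K. 1)"
    by (rule sum.mono_neutral_cong_right) (use assms cliquesD[OF assms(3)] in auto)
  moreover have "(\<Sum>K\<in>{K}. \<Prod>v\<in>K. ?y v) \<le> clique_poly k G ?y"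
    by (rule clique_poly_mono) (use assms in auto)
  ultimately have "1 \<le> clique_poly k G ?y" "real k * clique_poly k G ?y \<le> real k * clique_spectral_radius k G"
    using cliquesD(3)[OF assms(3)] by (simp_all add: mult.commute)
  with assms(2) show ?thesis by simp
qed

section \<open>Weighted clique counts in graphs without larger cliques\<close>

lemma insert_clique:
  assumes S: "S \<in> cliques s (Graph N E)" and N: "N \<subseteq> W" and u: "u \<in> W" "\<And>x. x \<in> N \<Longrightarrow> x \<noteq> u \<and> {u, x} \<in> E"
  shows "insert u S \<in> cliques (Suc s) (Graph W E)" "u \<notin> S"
proof -
  show nu: "u \<notin> S" using cliquesD(1)[OF S] u by auto
  show "insert u S \<in> cliques (Suc s) (Graph W E)"
    using cliquesD[OF S] N u nu unfolding cliques_def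
    by (auto simp: insert_commute subset_iff)
qed

lemma cliques_containing:
  fixes u :: 'a
  assumes u: "u \<in> W"
  shows "{K \<in> cliques (Suc s) (Graph W E). u \<in> K}
    = insert u ` cliques s (Graph {x \<in> W. x \<noteq> u \<and> {u, x} \<in> E} E)"
proof (intro equalityI subsetI)
  fix K assume K: "K \<in> {K \<in> cliques (Suc s) (Graph W E). u \<in> K}"
  then have "K - {u} \<in> cliques s (Graph {x \<in> W. x \<noteq> u \<and> {u, x} \<in> E} E)"
    by (auto simp: cliques_def)
  moreover have "K = insert u (K - {u})" using K by auto
  ultimately show "K \<in> insert u ` cliques s (Graph {x \<in> W. x \<noteq> u \<and> {u, x} \<in> E} E)" by blast
next
  fix K assume "K \<in> insert u ` cliques s (Graph {x \<in> W. x \<noteq> u \<and> {u, x} \<in> E} E)"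
  then show "K \<in> {K \<in> cliques (Suc s) (Graph W E). u \<in> K}"
  proof -
    assume "K \<in> insert u ` cliques s (Graph {x \<in> W. x \<noteq> u \<and> {u, x} \<in> E} E)"
    then obtain S where S: "K = insert u S" "S \<in> cliques s (Graph {x \<in> W. x \<noteq> u \<and> {u, x} \<in> E} E)" ..
    have "insert u S \<in> cliques (Suc s) (Graph W E)"
      by (rule insert_clique(1)[OF S(2) _ u]) auto
    with S(1) show ?thesis by blast
  qed
qed

lemma sum_cliques_containing:
  fixes w :: "'a \<Rightarrow> real"
  assumes u: "u \<in> W"
  shows "(\<Sum>K | K \<in> cliques (Suc s) (Graph W E) \<and> u \<in> K. \<Prod>v\<in>K. w v)
    = w u * clique_poly s (Graph {x \<in> W. x \<noteq> u \<and> {u, x} \<in> E} E) w"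
proof -
  let ?N = "{x \<in> W. x \<noteq> u \<and> {u, x} \<in> E}"
  have nu: "u \<notin> S" "finite S" if "S \<in> cliques s (Graph ?N E)" for S
    using cliquesD(1,2)[OF that] by auto
  have "inj_on (insert u) (cliques s (Graph ?N E))"
    by (rule inj_on_inverseI[where g = "\<lambda>K. K - {u}"]) (use nu(1) in auto)
  then show ?thesis
    unfolding cliques_containing[OF u] clique_poly_def sum_distrib_left
    using sum.reindex[of "insert u" "cliques s (Graph ?N E)" "\<lambda>K. \<Prod>v\<in>K. w v"]
    by (simp add: nu)
qed

text \<open>Take \<open>x\<close> itself in its own colour class and one representative of every other class.\<close>

lemma transversal_clique:
  assumes fin: "finite W" and x: "x \<in> W"
    and ne: "\<forall>j<s. \<exists>v\<in>W. c v = j" and c: "\<forall>v\<in>W. c v < s"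
    and multi: "\<forall>u\<in>W. \<forall>v\<in>W. c u \<noteq> c v \<longrightarrow> {u, v} \<in> E"
  obtains S where "S \<in> cliques s (Graph W E)" "x \<in> S" "\<And>v. v \<in> S \<Longrightarrow> c v = c x \<Longrightarrow> v = x"
proof -
  obtain f where f: "\<And>j. j < s \<Longrightarrow> f j \<in> W \<and> c (f j) = j" using ne by metis
  define g where "g = f(c x := x)"
  have g: "g j \<in> W" "c (g j) = j" if "j < s" for j using f[OF that] x by (auto simp: g_def)
  have "inj_on g {..<s}" using g(2) by (metis inj_on_def lessThan_iff)
  then have "g ` {..<s} \<in> cliques s (Graph W E)"
    unfolding cliques_def using g multi by (auto simp: card_image) (metis g)
  moreover have "x \<in> g ` {..<s}" using c x by (auto simp: g_def image_iff intro!: bexI[of _ "c x"])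
  moreover have "v = x" if "v \<in> g ` {..<s}" "c v = c x" for v
  proof -
    obtain j where "j < s" "v = g j" using \<open>v \<in> g ` {..<s}\<close> by blast
    with g(2) that(2) have "j = c x" by auto
    with \<open>v = g j\<close> show ?thesis by (simp add: g_def)
  qed
  ultimately show thesis using that by blast
qed

text \<open>This is Erdos's proof of Turan's theorem, carried out for weighted cliques. Let \<open>v\<close> be a vertex
  whose neighbourhood \<open>N\<close> has the heaviest family of \<open>s\<close>-cliques. Since \<open>N\<close> contains no
  \<open>(s+1)\<close>-clique, every \<open>(s+1)\<close>-clique of the graph meets the complement of \<open>N\<close>; charging it to a
  vertex there shows that replacing the complement of \<open>N\<close> by an independent set joined to \<open>N\<close> does
  not decrease the total weight. Induction inside \<open>N\<close> then yields the colouring. If nothing is lost,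
  every \<open>(s+1)\<close>-clique has exactly one vertex outside \<open>N\<close>, and a vertex outside \<open>N\<close> forms
  \<open>(s+1)\<close>-cliques with the same \<open>s\<close>-cliques of \<open>N\<close> as \<open>v\<close> does. These cover \<open>N\<close>, so every vertex
  outside \<open>N\<close> is adjacent to all of \<open>N\<close>.\<close>

theorem weighted_zykov:
  fixes w :: "'a \<Rightarrow> real"
  assumes "finite W" "cliques (Suc s) (Graph W E) = {}" "\<forall>v\<in>W. 0 \<le> w v"
  shows "\<exists>c. (\<forall>v\<in>W. c v < s) \<and> clique_poly s (Graph W E) w \<le> (\<Prod>j<s. \<Sum>v | v \<in> W \<and> c v = j. w v)
    \<and> (clique_poly s (Graph W E) w = (\<Prod>j<s. \<Sum>v | v \<in> W \<and> c v = j. w v)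
        \<and> (\<forall>v\<in>W. 0 < w v) \<and> (\<forall>j<s. \<exists>v\<in>W. c v = j)
       \<longrightarrow> (\<forall>u\<in>W. \<forall>v\<in>W. c u \<noteq> c v \<longrightarrow> {u, v} \<in> E))"
  using assms
proof (induction s arbitrary: W)
  case 0
  have "W = {}"
  proof (rule ccontr)
    assume "W \<noteq> {}"
    then obtain v where "v \<in> W" by blast
    then have "{v} \<in> cliques (Suc 0) (Graph W E)" by (auto simp: cliques_def)
    with "0.prems"(2) show False by blast
  qed
  moreover have "cliques 0 (Graph {} E) = {{}}" by (auto simp: cliques_def)
  ultimately show ?case by (auto simp: clique_poly_def)
next
  case (Suc s)
  let ?G = "Graph W E"
  have fin: "finite W" and w: "\<And>v. v \<in> W \<Longrightarrow> 0 \<le> w v" using Suc.prems by auto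
  show ?case
  proof (cases "W = {}")
    case True
    then have "cliques (Suc s) ?G = {}" by (auto simp: cliques_def)
    with True show ?thesis by (intro exI[of _ "\<lambda>_. 0"]) (auto simp: clique_poly_def)
  next
    case False
    define N where "N = (\<lambda>u. {x \<in> W. x \<noteq> u \<and> {u, x} \<in> E})"
    define d where "d = (\<lambda>u. clique_poly s (Graph (N u) E) w)"
    have NW: "N u \<subseteq> W" for u by (auto simp: N_def)
    have d0: "0 \<le> d u" for u unfolding d_def using NW w by (intro clique_poly_nonneg) auto
    obtain v where v: "v \<in> W" and vmax: "\<And>u. u \<in> W \<Longrightarrow> d u \<le> d v"
    proof -
      have "Max (d ` W) \<in> d ` W" using fin False by (intro Max_in) auto
      then obtain v where "v \<in> W" "d v = Max (d ` W)" by auto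
      then show thesis using that[of v] fin by simp
    qed
    have free: "cliques (Suc s) (Graph (N v) E) = {}"
    proof (rule ccontr)
      assume "cliques (Suc s) (Graph (N v) E) \<noteq> {}"
      then obtain S where "S \<in> cliques (Suc s) (Graph (N v) E)" by blast
      then have "insert v S \<in> cliques (Suc (Suc s)) ?G"
        by (rule insert_clique(1)[OF _ NW v]) (auto simp: N_def)
      with Suc.prems(2) show False by blast
    qed
    have finN: "finite (N v)" using fin NW finite_subset by blast
    obtain c where c: "\<forall>x\<in>N v. c x < s"
      and cle: "d v \<le> (\<Prod>j<s. \<Sum>x | x \<in> N v \<and> c x = j. w x)"
      and ceq: "d v = (\<Prod>j<s. \<Sum>x | x \<in> N v \<and> c x = j. w x) \<Longrightarrow> \<forall>x\<in>N v. 0 < w x \<Longrightarrow>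
        \<forall>j<s. \<exists>x\<in>N v. c x = j \<Longrightarrow> \<forall>u\<in>N v. \<forall>x\<in>N v. c u \<noteq> c x \<longrightarrow> {u, x} \<in> E"
      using Suc.IH[OF finN free] w NW unfolding d_def by (smt (verit) subsetD)
    define c' where "c' = (\<lambda>x. if x \<in> N v then c x else s)"
    let ?U = "W - N v"
    have vU: "v \<in> ?U" using v by (auto simp: N_def)
    have parts: "(\<Prod>j<Suc s. \<Sum>x | x \<in> W \<and> c' x = j. w x)
        = (\<Prod>j<s. \<Sum>x | x \<in> N v \<and> c x = j. w x) * (\<Sum>x\<in>?U. w x)"
    proof -
      have "{x. x \<in> W \<and> c' x = j} = {x. x \<in> N v \<and> c x = j}" if "j < s" for j
        using that NW by (auto simp: c'_def)
      moreover have "{x. x \<in> W \<and> c' x = s} = ?U" using c by (auto simp: c'_def)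
      ultimately show ?thesis by simp
    qed
    have cov: "card (S \<inter> ?U) \<ge> 1" if S: "S \<in> cliques (Suc s) ?G" for S
    proof (rule ccontr)
      assume "\<not> card (S \<inter> ?U) \<ge> 1"
      then have "S \<inter> ?U = {}" using cliquesD(2)[OF S] by (simp add: not_le)
      then have "S \<in> cliques (Suc s) (Graph (N v) E)" using S by (auto simp: cliques_def)
      with free show False by blast
    qed
    \<comment> \<open>A double count of the pairs of an \<open>(s+1)\<close>-clique and one of its vertices outside \<open>N v\<close>.\<close>
    have charge: "(\<Sum>S\<in>cliques (Suc s) ?G. card (S \<inter> ?U) * (\<Prod>x\<in>S. w x)) = (\<Sum>u\<in>?U. w u * d u)"
    proof -
      have "(\<Sum>S\<in>cliques (Suc s) ?G. card (S \<inter> ?U) * (\<Prod>x\<in>S. w x))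
          = (\<Sum>S\<in>cliques (Suc s) ?G. \<Sum>u | u \<in> ?U \<and> u \<in> S. \<Prod>x\<in>S. w x)"
        by (intro sum.cong refl) (simp add: Int_def conj_commute)
      also have "\<dots> = (\<Sum>u\<in>?U. \<Sum>S | S \<in> cliques (Suc s) ?G \<and> u \<in> S. \<Prod>x\<in>S. w x)"
        by (rule sum.swap_restrict) (use fin in \<open>auto intro!: finite_cliques\<close>)
      also have "\<dots> = (\<Sum>u\<in>?U. w u * d u)"
        by (intro sum.cong refl) (simp add: sum_cliques_containing d_def N_def)
      finally show ?thesis .
    qed
    have pnn: "0 \<le> (\<Prod>x\<in>S. w x)" if "S \<in> cliques (Suc s) ?G" for S
      using cliquesD(1)[OF that] w by (intro prod_nonneg) auto
    have le1: "clique_poly (Suc s) ?G w \<le> (\<Sum>u\<in>?U. w u * d u)"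
      unfolding charge[symmetric] clique_poly_def
    proof (rule sum_mono)
      fix S assume "S \<in> cliques (Suc s) ?G"
      then show "(\<Prod>x\<in>S. w x) \<le> card (S \<inter> ?U) * (\<Prod>x\<in>S. w x)"
        using cov[of S] pnn[of S] mult_right_mono[of 1 "real (card (S \<inter> ?U))" "\<Prod>x\<in>S. w x"] by simp
    qed
    have le2: "(\<Sum>u\<in>?U. w u * d u) \<le> (\<Sum>u\<in>?U. w u * d v)"
      by (intro sum_mono mult_left_mono) (use vmax w in auto)
    have le3: "(\<Sum>u\<in>?U. w u * d v) \<le> (\<Prod>j<Suc s. \<Sum>x | x \<in> W \<and> c' x = j. w x)"
      unfolding parts sum_distrib_right[symmetric] using cle w
      by (metis (no_types, lifting) DiffD1 mult.commute mult_left_mono sum_nonneg)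
    have "\<forall>u\<in>W. \<forall>x\<in>W. c' u \<noteq> c' x \<longrightarrow> {u, x} \<in> E"
      if eq: "clique_poly (Suc s) ?G w = (\<Prod>j<Suc s. \<Sum>x | x \<in> W \<and> c' x = j. w x)"
        and pos: "\<forall>x\<in>W. 0 < w x" and ne: "\<forall>j<Suc s. \<exists>x\<in>W. c' x = j"
    proof -
      have e1: "clique_poly (Suc s) ?G w = (\<Sum>u\<in>?U. w u * d u)"
        and e2: "(\<Sum>u\<in>?U. w u * d u) = (\<Sum>u\<in>?U. w u * d v)"
        and e3: "(\<Sum>u\<in>?U. w u * d v) = (\<Prod>j<Suc s. \<Sum>x | x \<in> W \<and> c' x = j. w x)"
        using eq le1 le2 le3 by auto
      have "0 < w v" using pos v by simp
      also have "w v \<le> (\<Sum>x\<in>?U. w x)" using vU fin w by (intro member_le_sum) auto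
      finally have sU: "0 < (\<Sum>x\<in>?U. w x)" .
      then have dv: "d v = (\<Prod>j<s. \<Sum>x | x \<in> N v \<and> c x = j. w x)"
        using e3 unfolding parts sum_distrib_right[symmetric] by simp
      have ne': "\<forall>j<s. \<exists>x\<in>N v. c x = j"
      proof (intro allI impI)
        fix j assume j: "j < s"
        then obtain x where "x \<in> W" "c' x = j" using ne less_SucI by blast
        with j show "\<exists>x\<in>N v. c x = j" by (auto simp: c'_def split: if_splits)
      qed
      have multi: "\<forall>u\<in>N v. \<forall>x\<in>N v. c u \<noteq> c x \<longrightarrow> {u, x} \<in> E"
        using ceq[OF dv _ ne'] pos NW by blast
      have du: "d u = d v" if "u \<in> ?U" for u
      proof -
        have "(\<Sum>u\<in>?U. w u * (d v - d u)) = 0"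
          using e2 by (simp add: right_diff_distrib sum_subtractf)
        then have "\<forall>u\<in>?U. w u * (d v - d u) = 0"
          using fin vmax w by (subst (asm) sum_nonneg_eq_0_iff) auto
        with that pos show ?thesis by force
      qed
      have one: "card (S \<inter> ?U) = 1" if S: "S \<in> cliques (Suc s) ?G" for S
      proof -
        have pp: "0 < (\<Prod>x\<in>S. w x)" using cliquesD(1)[OF S] pos by (intro prod_pos) auto
        have "(\<Sum>S\<in>cliques (Suc s) ?G. (real (card (S \<inter> ?U)) - 1) * (\<Prod>x\<in>S. w x)) = 0"
          using e1 unfolding charge[symmetric] clique_poly_def by (simp add: left_diff_distrib sum_subtractf)
        then have "\<forall>S\<in>cliques (Suc s) ?G. (real (card (S \<inter> ?U)) - 1) * (\<Prod>x\<in>S. w x) = 0"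
          using fin cov pnn by (subst (asm) sum_nonneg_eq_0_iff) (auto intro!: finite_cliques)
        with S pp show ?thesis by force
      qed
      have NN: "N v \<subseteq> N u" if u: "u \<in> ?U" for u
      proof
        fix x assume x: "x \<in> N v"
        have sub: "cliques s (Graph (N u) E) \<subseteq> cliques s (Graph (N v) E)"
        proof
          fix S assume S: "S \<in> cliques s (Graph (N u) E)"
          have "insert u S \<in> cliques (Suc s) ?G" "u \<notin> S"
            using insert_clique[OF S NW, of u] u by (auto simp: N_def)
          then have "card (insert u S \<inter> ?U) = 1" "u \<in> insert u S \<inter> ?U" using one u by blast+
          then have "insert u S \<inter> ?U = {u}" by (metis card_1_singletonE singletonD)
          then have "S \<subseteq> N v" using \<open>u \<notin> S\<close> cliquesD(1)[OF S] NW[of u] by auto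
          then show "S \<in> cliques s (Graph (N v) E)" using S by (auto simp: cliques_def)
        qed
        have "\<not> cliques s (Graph (N u) E) \<subset> cliques s (Graph (N v) E)"
        proof
          assume ps: "cliques s (Graph (N u) E) \<subset> cliques s (Graph (N v) E)"
          then obtain S where S: "S \<in> cliques s (Graph (N v) E) - cliques s (Graph (N u) E)" by blast
          have "d u < d v" unfolding d_def clique_poly_def
          proof (rule sum_strict_mono2[OF _ sub S])
            show "finite (cliques s (Graph (N v) E))" using finN by (intro finite_cliques) auto
            show "0 < (\<Prod>x\<in>S. w x)" using S cliquesD(1)[of S s "Graph (N v) E"] NW pos
              by (intro prod_pos) auto
            show "0 \<le> (\<Prod>x\<in>T. w x)" if "T \<in> cliques s (Graph (N v) E)" for T
              using cliquesD(1)[OF that] NW w by (intro prod_nonneg) auto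
          qed
          with du[OF u] show False by simp
        qed
        with sub have same: "cliques s (Graph (N u) E) = cliques s (Graph (N v) E)" by blast
        obtain S where "S \<in> cliques s (Graph (N v) E)" "x \<in> S"
          by (rule transversal_clique[OF finN x ne' c multi]) blast
        with same have "S \<in> cliques s (Graph (N u) E)" by simp
        then show "x \<in> N u" using \<open>x \<in> S\<close> cliquesD(1)[of S s "Graph (N u) E"] by auto
      qed
      have cross: "{u, x} \<in> E" if "u \<in> ?U" "x \<in> N v" for u x
        using NN[OF that(1)] that(2) by (auto simp: N_def)
      show ?thesis
      proof (intro ballI impI)
        fix u x assume ux: "u \<in> W" "x \<in> W" "c' u \<noteq> c' x"
        consider "u \<in> N v" "x \<in> N v" | "u \<in> ?U" "x \<in> N v" | "u \<in> N v" "x \<in> ?U" | "u \<in> ?U" "x \<in> ?U"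
          using ux by blast
        then show "{u, x} \<in> E"
          using multi cross[of u x] cross[of x u] ux(3) by cases (auto simp: c'_def insert_commute)
      qed
    qed
    then show ?thesis
      using le1 le2 le3 c by (intro exI[of _ c']) (auto simp: c'_def less_Suc_eq)
  qed
qed

section \<open>Bounding the clique spectral radius by the number of cliques\<close>

lemma power_mean:
  fixes z :: "'b \<Rightarrow> real"
  assumes "finite I" "\<And>i. i \<in> I \<Longrightarrow> 0 \<le> z i" "k \<ge> 1"
  shows "(\<Sum>i\<in>I. z i) ^ k \<le> real (card I) ^ (k - 1) * (\<Sum>i\<in>I. z i ^ k)"
proof (cases "I = {}")
  case True
  with assms(3) show ?thesis by (simp add: zero_power)
next
  case False
  define m where "m = real (card I)"
  have m: "m > 0" using False assms(1) by (simp add: m_def card_gt_0_iff)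
  have "convex_on {0::real..} (\<lambda>x. x ^ k)"
  proof (cases "even k")
    case True
    then show ?thesis using convex_power_even convex_on_subset by blast
  qed (rule convex_power_odd)
  then have "(\<Sum>i\<in>I. (1 / m) *\<^sub>R z i) ^ k \<le> (\<Sum>i\<in>I. (1 / m) * z i ^ k)"
    by (intro convex_on_sum[OF assms(1) False]) (use m assms in \<open>auto simp: m_def\<close>)
  then have "(\<Sum>i\<in>I. z i) ^ k / m ^ k \<le> (\<Sum>i\<in>I. z i ^ k) / m"
    by (simp add: sum_divide_distrib[symmetric] power_divide)
  moreover have "m ^ k = m * m ^ (k - 1)" using assms(3) by (simp add: power_eq_if)
  ultimately show ?thesis using m by (simp add: m_def[symmetric] field_simps)
qed

text \<open>Multiply the inequalities \<open>z / m \<le> exp (z / m - 1)\<close>, where \<open>m\<close> is the arithmetic mean; the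
  exponents on the right add up to \<open>0\<close>.\<close>

lemma arith_geo_mean_prod:
  fixes z :: "'b \<Rightarrow> real"
  assumes "finite I" "I \<noteq> {}" "\<And>i. i \<in> I \<Longrightarrow> 0 \<le> z i"
  shows "(\<Prod>i\<in>I. z i) \<le> ((\<Sum>i\<in>I. z i) / card I) ^ card I"
proof (cases "(\<Sum>i\<in>I. z i) = 0")
  case True
  then have "\<forall>i\<in>I. z i = 0" using assms by (simp add: sum_nonneg_eq_0_iff)
  with assms have "(\<Prod>i\<in>I. z i) = 0" by (meson all_not_in_conv prod_zero)
  with True show ?thesis by simp
next
  case False
  define m where "m = (\<Sum>i\<in>I. z i) / card I"
  have c: "real (card I) > 0" using assms by (simp add: card_gt_0_iff)
  have "0 \<le> (\<Sum>i\<in>I. z i)" by (rule sum_nonneg) (rule assms(3))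
  with False c have m: "m > 0" by (simp add: m_def)
  have "(\<Prod>i\<in>I. z i / m) \<le> (\<Prod>i\<in>I. exp (z i / m - 1))"
  proof (intro prod_mono conjI)
    fix i assume "i \<in> I"
    then show "0 \<le> z i / m" using assms(3) m by simp
    show "z i / m \<le> exp (z i / m - 1)" using exp_ge_add_one_self[of "z i / m - 1"] by simp
  qed
  also have "\<dots> = exp (\<Sum>i\<in>I. z i / m - 1)" by (simp add: exp_sum assms(1))
  also have "(\<Sum>i\<in>I. z i / m - 1) = (\<Sum>i\<in>I. z i) / m - card I"
    by (simp add: sum_subtractf sum_divide_distrib)
  also have "\<dots> = 0" using False c by (simp add: m_def)
  finally have "(\<Prod>i\<in>I. z i) / m ^ card I \<le> 1" by (simp add: prod_dividef)
  then show ?thesis using m by (simp add: m_def[symmetric] divide_simps)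
qed

text \<open>All the products in the form occur in the expansion of \<open>\<Prod>v. (1 + y v)\<close>.\<close>

lemma clique_poly_le_exp:
  assumes fin: "finite (verts G)" and y: "\<And>v. v \<in> verts G \<Longrightarrow> 0 \<le> y v" and s: "(\<Sum>v\<in>verts G. y v) = 1"
  shows "clique_poly k G y \<le> exp 1"
proof -
  have "clique_poly k G y \<le> (\<Sum>S\<in>Pow (verts G). \<Prod>v\<in>S. y v)"
    unfolding clique_poly_def
    by (rule sum_mono2) (use fin y in \<open>auto intro!: prod_nonneg dest: cliquesD(1)\<close>)
  also have "\<dots> = (\<Prod>v\<in>verts G. y v + 1)"
    using prod_add[OF fin, of y "\<lambda>_. 1"] by simp
  also have "\<dots> \<le> (\<Prod>v\<in>verts G. exp (y v))"
    by (intro prod_mono conjI) (use y exp_ge_add_one_self in \<open>auto simp: add.commute\<close>)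
  also have "\<dots> = exp 1" by (simp add: exp_sum[OF fin, symmetric] s)
  finally show ?thesis .
qed

text \<open>The colour classes of \<open>weighted_zykov\<close> turn the clique sum into a product of \<open>k\<close> numbers with
  sum \<open>1\<close>; this is the analogue of the Motzkin-Straus inequality for \<open>k\<close>-cliques.\<close>

lemma clique_poly_le_motzkin_straus:
  assumes fin: "finite (verts G)" and y: "\<And>v. v \<in> verts G \<Longrightarrow> 0 \<le> y v" and s: "(\<Sum>v\<in>verts G. y v) = 1"
    and free: "cliques (Suc k) G = {}" and k: "k \<ge> 1"
  shows "clique_poly k G y \<le> (1 / k) ^ k"
proof -
  have G: "Graph (verts G) (edges G) = G" by simp
  obtain c where c: "\<forall>v\<in>verts G. c v < k"
    and le: "clique_poly k G y \<le> (\<Prod>j<k. \<Sum>v | v \<in> verts G \<and> c v = j. y v)"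
    using weighted_zykov[of "verts G" k "edges G" y] fin free y unfolding G by blast
  note le
  also have "(\<Prod>j<k. \<Sum>v | v \<in> verts G \<and> c v = j. y v)
      \<le> ((\<Sum>j<k. \<Sum>v | v \<in> verts G \<and> c v = j. y v) / card {..<k}) ^ card {..<k}"
    by (rule arith_geo_mean_prod) (use k y in \<open>auto intro!: sum_nonneg simp: lessThan_empty_iff\<close>)
  also have "(\<Sum>j<k. \<Sum>v | v \<in> verts G \<and> c v = j. y v) = (\<Sum>v\<in>verts G. y v)"
    by (rule sum.group) (use c fin in auto)
  finally show ?thesis using s by simp
qed

text \<open>Hoelder's inequality, with the substitution \<open>y = x^k\<close>, separates the number of cliques from a
  bound on the form over the simplex.\<close>

lemma clique_spectral_radius_power_le:
  assumes fin: "finite (verts G)" "verts G \<noteq> {}" and k: "k \<ge> 2"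
    and bound: "\<And>y. (\<And>v. v \<in> verts G \<Longrightarrow> 0 \<le> y v) \<Longrightarrow> (\<Sum>v\<in>verts G. y v) = 1 \<Longrightarrow> clique_poly k G y \<le> b"
  shows "clique_spectral_radius k G ^ k \<le> real k ^ k * real (card (cliques k G)) ^ (k - 1) * b"
proof -
  obtain x where x: "\<And>v. 0 \<le> x v" "(\<Sum>v\<in>verts G. x v ^ k) = 1"
    and mu: "clique_spectral_radius k G = k * clique_poly k G x"
    using clique_spectral_radius_variational[OF fin k] by metis
  have "clique_poly k G x ^ k \<le> real (card (cliques k G)) ^ (k - 1) * (\<Sum>K\<in>cliques k G. (\<Prod>v\<in>K. x v) ^ k)"
    unfolding clique_poly_def
    by (rule power_mean) (use k x(1) in \<open>auto intro!: finite_cliques[OF fin(1)] prod_nonneg\<close>)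
  also have "(\<Sum>K\<in>cliques k G. (\<Prod>v\<in>K. x v) ^ k) = clique_poly k G (\<lambda>v. x v ^ k)"
    by (simp add: clique_poly_def prod_power_distrib)
  also have "\<dots> \<le> b" using x by (intro bound) auto
  finally have "clique_poly k G x ^ k \<le> real (card (cliques k G)) ^ (k - 1) * b"
    by (simp add: mult_left_mono)
  then have "real k ^ k * clique_poly k G x ^ k \<le> real k ^ k * (real (card (cliques k G)) ^ (k - 1) * b)"
    by (rule mult_left_mono) simp
  then show ?thesis unfolding mu by (simp only: power_mult_distrib mult.assoc)
qed

corollary clique_spectral_radius_power_le_exp:
  assumes "finite (verts G)" "verts G \<noteq> {}" "k \<ge> 2"
  shows "clique_spectral_radius k G ^ k \<le> real k ^ k * real (card (cliques k G)) ^ (k - 1) * exp 1"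
  by (rule clique_spectral_radius_power_le[OF assms]) (use clique_poly_le_exp[OF assms(1)] in blast)

corollary clique_spectral_radius_power_le_card:
  assumes "finite (verts G)" "verts G \<noteq> {}" "k \<ge> 2" "cliques (Suc k) G = {}"
  shows "clique_spectral_radius k G ^ k \<le> real (card (cliques k G)) ^ (k - 1)"
proof -
  have "clique_spectral_radius k G ^ k \<le> real k ^ k * real (card (cliques k G)) ^ (k - 1) * (1 / k) ^ k"
    by (rule clique_spectral_radius_power_le[OF assms(1-3)])
      (use clique_poly_le_motzkin_straus[OF assms(1) _ _ assms(4)] assms(3) in simp)
  also have "\<dots> = real (card (cliques k G)) ^ (k - 1)" using assms(3) by (simp add: power_divide)
  finally show ?thesis .
qed

section \<open>Cliques in graphs without two disjoint copies of a complete graph\<close>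

lemma contains_two_complete_graphs:
  assumes X: "X \<in> cliques r G" and Y: "Y \<in> cliques r G" and disj: "X \<inter> Y = {}"
  shows "contains_subgraph G (disjoint_union (complete_graph r) (complete_graph r))"
proof -
  obtain f where f: "bij_betw f {..<r} X"
    using ex_bij_betw_nat_finite[OF cliquesD(2)[OF X]] cliquesD(3)[OF X] by (auto simp: atLeast0LessThan)
  obtain g where g: "bij_betw g {..<r} Y"
    using ex_bij_betw_nat_finite[OF cliquesD(2)[OF Y]] cliquesD(3)[OF Y] by (auto simp: atLeast0LessThan)
  have fX: "f ` {..<r} = X" "inj_on f {..<r}" and gY: "g ` {..<r} = Y" "inj_on g {..<r}"
    using f g by (auto simp: bij_betw_def)
  have fe: "{f u, f v} \<in> edges G" "{g u, g v} \<in> edges G" if "u < r" "v < r" "u \<noteq> v" for u v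
  proof -
    have "f u \<in> X" "f v \<in> X" "f u \<noteq> f v" "g u \<in> Y" "g v \<in> Y" "g u \<noteq> g v"
      using that fX gY by (auto dest: inj_onD)
    then show "{f u, f v} \<in> edges G" "{g u, g v} \<in> edges G"
      using cliquesD(4)[OF X] cliquesD(4)[OF Y] by auto
  qed
  show ?thesis
    unfolding contains_subgraph_def
  proof (intro exI[of _ "case_sum f g"] conjI)
    show "inj_on (case_sum f g) (verts (disjoint_union (complete_graph r) (complete_graph r)))"
    proof (rule inj_onI)
      fix p p' assume "p \<in> verts (disjoint_union (complete_graph r) (complete_graph r))"
        "p' \<in> verts (disjoint_union (complete_graph r) (complete_graph r))" "case_sum f g p = case_sum f g p'"
      then show "p = p'"
        using fX gY disj
        by (auto simp: disjoint_union_def complete_graph_def inj_on_eq_iff) (metis IntI empty_iff image_eqI lessThan_iff)+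
    qed
    show "case_sum f g ` verts (disjoint_union (complete_graph r) (complete_graph r)) \<subseteq> verts G"
    proof
      fix v assume "v \<in> case_sum f g ` verts (disjoint_union (complete_graph r) (complete_graph r))"
      then have "v \<in> X \<union> Y" unfolding fX(1)[symmetric] gY(1)[symmetric]
        by (auto simp: disjoint_union_def complete_graph_def)
      then show "v \<in> verts G" using cliquesD(1)[OF X] cliquesD(1)[OF Y] by blast
    qed
    show "\<forall>e\<in>edges (disjoint_union (complete_graph r) (complete_graph r)). case_sum f g ` e \<in> edges G"
      using fe by (auto simp: disjoint_union_def complete_graph_def)
  qed
qed

lemma disjoint_subsets_of_card:
  assumes "finite S" "finite T" "r \<le> card S" "r \<le> card T" "2 * r \<le> card (S \<union> T)"
  obtains X Y where "X \<subseteq> S" "Y \<subseteq> T" "X \<inter> Y = {}" "card X = r" "card Y = r"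
proof -
  \<comment> \<open>\<open>X\<close> uses up as much of \<open>S - T\<close> as possible.\<close>
  obtain X where X: "X \<subseteq> S" "card X = r" "S - T \<subseteq> X \<or> X \<subseteq> S - T"
  proof (cases "r \<le> card (S - T)")
    case True
    then obtain X where "X \<subseteq> S - T" "card X = r" using assms(1) by (metis obtain_subset_with_card_n)
    then show thesis using that by blast
  next
    case False
    then obtain X where "S - T \<subseteq> X" "X \<subseteq> S" "card X = r"
      using exists_subset_between[of "S - T" r S] assms by auto
    then show thesis using that by blast
  qed
  have "r \<le> card (T - X)"
    using X(3)
  proof
    assume "S - T \<subseteq> X"
    then have "S \<union> T = X \<union> (T - X)" using X(1) by blast
    then have "card (S \<union> T) \<le> card X + card (T - X)" by (metis card_Un_le)
    with assms(5) X(2) show ?thesis by simp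
  next
    assume "X \<subseteq> S - T"
    then have "T - X = T" by blast
    with assms(4) show ?thesis by simp
  qed
  then obtain Y where "Y \<subseteq> T - X" "card Y = r" using assms(2) by (metis finite_Diff obtain_subset_with_card_n)
  with X that show thesis by blast
qed

lemma cliques_intersect:
  assumes free: "free_of (disjoint_union (complete_graph r) (complete_graph r)) G" and rk: "r \<le> k"
    and S: "S \<in> cliques k G" and T: "T \<in> cliques k G"
  shows "2 * k + 1 - 2 * r \<le> card (S \<inter> T)"
proof (rule ccontr)
  assume "\<not> 2 * k + 1 - 2 * r \<le> card (S \<inter> T)"
  moreover have "card S + card T = card (S \<union> T) + card (S \<inter> T)"
    by (intro card_Un_Int cliquesD(2)[OF S] cliquesD(2)[OF T])
  ultimately have "2 * r \<le> card (S \<union> T)" using cliquesD(3)[OF S] cliquesD(3)[OF T] by linarith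
  then obtain X Y where XY: "X \<subseteq> S" "Y \<subseteq> T" "X \<inter> Y = {}" "card X = r" "card Y = r"
    using disjoint_subsets_of_card[of S T r] cliquesD(2,3)[OF S] cliquesD(2,3)[OF T] rk by metis
  have "finite X" "finite Y"
    using XY(1,2) cliquesD(2)[OF S] cliquesD(2)[OF T] finite_subset by blast+
  then have "X \<in> cliques r G" "Y \<in> cliques r G"
    using XY S T unfolding cliques_def by (simp_all add: subset_iff)
  with contains_two_complete_graphs[OF _ _ XY(3)] free show False by (simp add: free_of_def)
qed

section \<open>Intersecting families without a common core\<close>

text \<open>Fix a member \<open>F1\<close>. Every member contains an \<open>a\<close>-subset \<open>X\<close> of \<open>F1\<close>; some member \<open>T\<close> does not
  contain \<open>X\<close>, and every member containing \<open>X\<close> shares with \<open>T\<close> a point outside \<open>X\<close>. So each member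
  is determined by \<open>X\<close>, a point of \<open>T\<close> and the \<open>s\<close> remaining points.\<close>

lemma card_intersecting_family_le:
  assumes fin: "finite V" and F: "\<And>S. S \<in> F \<Longrightarrow> S \<subseteq> V \<and> card S = a + Suc s"
    and int: "\<And>S T. S \<in> F \<Longrightarrow> T \<in> F \<Longrightarrow> a \<le> card (S \<inter> T)"
    and nocore: "\<And>X. card X = a \<Longrightarrow> \<exists>T\<in>F. \<not> X \<subseteq> T"
  shows "card F \<le> (a + Suc s choose a) * (a + Suc s) * (card V choose s)"
proof (cases "F = {}")
  case False
  then obtain F1 where F1: "F1 \<in> F" by blast
  have finF: "finite S" if "S \<in> F" for S using F[OF that] fin finite_subset by blast
  obtain g where g: "\<And>X. card X = a \<Longrightarrow> g X \<in> F \<and> \<not> X \<subseteq> g X" using nocore by metis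
  define Xs where "Xs = {X. X \<subseteq> F1 \<and> card X = a}"
  define Rs where "Rs = {R. R \<subseteq> V \<and> card R = s}"
  let ?D = "(SIGMA X:Xs. g X) \<times> Rs"
  have finXs: "finite Xs" using finF[OF F1] unfolding Xs_def by simp
  have finRs: "finite Rs" unfolding Rs_def using fin by simp
  have cover: "F \<subseteq> (\<lambda>((X, z), R). insert z (X \<union> R)) ` ?D"
  proof
    fix S assume S: "S \<in> F"
    obtain X where X: "X \<subseteq> S \<inter> F1" "card X = a"
      using int[OF S F1] by (metis finite_Int finF[OF S] obtain_subset_with_card_n)
    have finX: "finite X" using X finF[OF S] finite_subset by blast
    have gX: "g X \<in> F" "\<not> X \<subseteq> g X" using g X by auto
    have "\<not> S \<inter> g X \<subseteq> X"
    proof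
      assume "S \<inter> g X \<subseteq> X"
      with gX(2) have "S \<inter> g X \<subset> X" by blast
      then have "card (S \<inter> g X) < card X" using finX psubset_card_mono by blast
      with int[OF S gX(1)] X(2) show False by simp
    qed
    then obtain z where z: "z \<in> S" "z \<in> g X" "z \<notin> X" by blast
    have "card (S - insert z X) = card S - card (insert z X)"
      using X z finX by (intro card_Diff_subset) auto
    then have "card (S - insert z X) = s" using F[OF S] z X finX by simp
    then have R: "S - insert z X \<in> Rs" using F[OF S] by (auto simp: Rs_def)
    show "S \<in> (\<lambda>((X, z), R). insert z (X \<union> R)) ` ?D"
    proof (rule image_eqI[where x = "((X, z), S - insert z X)"])
      show "S = (\<lambda>((X, z), R). insert z (X \<union> R)) ((X, z), S - insert z X)" using X z by auto
      show "((X, z), S - insert z X) \<in> ?D" using X z R by (auto simp: Xs_def)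
    qed
  qed
  have "finite (SIGMA X:Xs. g X)"
    using finXs finF g by (intro finite_SigmaI) (auto simp: Xs_def)
  then have "finite ?D" using finRs by (rule finite_cartesian_product)
  then have "card F \<le> card ?D" using cover by (rule surj_card_le)
  also have "\<dots> = (\<Sum>X\<in>Xs. card (g X)) * card Rs"
    using finXs finF g by (simp add: card_cartesian_product Xs_def)
  also have "(\<Sum>X\<in>Xs. card (g X)) = (\<Sum>X\<in>Xs. a + Suc s)"
    by (intro sum.cong) (use F g in \<open>auto simp: Xs_def\<close>)
  also have "\<dots> = (a + Suc s choose a) * (a + Suc s)"
    using F[OF F1] finF[OF F1] n_subsets[of F1 a] by (simp add: Xs_def)
  also have "card Rs = card V choose s" using n_subsets[OF fin] by (simp add: Rs_def)
  finally show ?thesis .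
qed simp

section \<open>Products of part sizes\<close>

lemma card_residue_class:
  assumes "j < s"
  shows "card {v. v < M \<and> v mod s = j} = M div s + (if j < M mod s then 1 else 0)"
proof -
  let ?q = "M div s + (if j < M mod s then 1 else 0)"
  have M: "M = M div s * s + M mod s" by simp
  have "{v. v < M \<and> v mod s = j} = (\<lambda>i. i * s + j) ` {..<?q}"
  proof (intro equalityI subsetI)
    fix v assume v: "v \<in> {v. v < M \<and> v mod s = j}"
    then have e: "v = v div s * s + j" by auto
    have "v div s \<le> M div s" using v by (simp add: div_le_mono)
    moreover have "j < M mod s" if "v div s = M div s"
      using v e M that by (metis (mono_tags, lifting) mem_Collect_eq nat_add_left_cancel_less)
    ultimately have "v div s < ?q" by (cases "v div s = M div s") auto
    with e show "v \<in> (\<lambda>i. i * s + j) ` {..<?q}" by blast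
  next
    fix v assume "v \<in> (\<lambda>i. i * s + j) ` {..<?q}"
    then obtain i where i: "i < ?q" "v = i * s + j" by blast
    have "v < M"
    proof (cases "i < M div s")
      case True
      then have "Suc i * s \<le> M div s * s" by (intro mult_le_mono1) simp
      then have "i * s + s \<le> M div s * s" by simp
      with i(2) assms M show ?thesis by linarith
    next
      case False
      with i(1) have "i = M div s" "j < M mod s" by (auto split: if_splits)
      then have "v = M div s * s + j" using i(2) by simp
      with M \<open>j < M mod s\<close> show ?thesis by linarith
    qed
    with i(2) assms show "v \<in> {v. v < M \<and> v mod s = j}" by simp
  qed
  moreover have "inj_on (\<lambda>i. i * s + j) {..<?q}" using assms by (intro inj_onI) simp
  ultimately show ?thesis by (simp add: card_image)
qed

text \<open>For integers the exponential \<open>q (1 + 1 / q)^(m - q)\<close> dominates \<open>m\<close> and touches it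
  exactly at \<open>q\<close> and \<open>q + 1\<close>. Multiplying over the parts shows that balanced part sizes maximise the
  product among all sizes with the given sum.\<close>

lemma balanced_exponential_bound:
  fixes q m :: nat
  defines "\<beta> \<equiv> 1 + 1 / real q"
  assumes q: "q \<ge> 1"
  shows "real m * \<beta> ^ q \<le> real q * \<beta> ^ m"
    and "m \<noteq> q \<Longrightarrow> m \<noteq> q + 1 \<Longrightarrow> real m * \<beta> ^ q < real q * \<beta> ^ m"
proof -
  have \<beta>: "\<beta> > 0" using q by (simp add: \<beta>_def add_pos_nonneg)
  have up: "real (q + d) \<le> real q * \<beta> ^ d" for d
  proof -
    have "1 + real d * (1 / q) \<le> \<beta> ^ d"
      unfolding \<beta>_def by (rule Bernoulli_inequality) (rule order.trans[of "- 1" 0], auto)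
    then have "real q * (1 + real d * (1 / q)) \<le> real q * \<beta> ^ d" by (intro mult_left_mono) auto
    then show ?thesis using q by (simp add: algebra_simps)
  qed
  have up': "real (q + Suc d) < real q * \<beta> ^ Suc d" if "d \<ge> 1" for d
  proof -
    have "real q * (1 / real q) = 1" using q by simp
    then have "\<beta> * real (q + d) = real (q + Suc d) + real d * (1 / real q)"
      unfolding \<beta>_def by (simp only: of_nat_add of_nat_Suc ring_distribs mult_1_left mult.commute)
    moreover have "0 < real d * (1 / real q)" using that q by simp
    ultimately have "real (q + Suc d) < \<beta> * real (q + d)" by linarith
    also have "\<dots> \<le> \<beta> * (real q * \<beta> ^ d)" using up \<beta> by (intro mult_left_mono) auto
    finally show ?thesis by (simp add: mult_ac)
  qed
  have down: "real (q - d) * \<beta> ^ d < real q" if d: "1 \<le> d" "d \<le> q" for d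
  proof -
    have inv: "(1 + - (1 / (real q + 1))) * \<beta> = 1"
      using q by (simp add: \<beta>_def field_simps add_nonneg_eq_0_iff)
    have "1 + real d * - (1 / (real q + 1)) \<le> (1 + - (1 / (real q + 1))) ^ d"
      by (rule Bernoulli_inequality) (simp add: field_simps)
    moreover have "real (q - d) < real q * (1 + real d * - (1 / (real q + 1)))"
      using d by (simp add: of_nat_diff field_simps)
    ultimately have "real (q - d) < real q * (1 + - (1 / (real q + 1))) ^ d"
      using q by (smt (verit) mult_left_mono of_nat_0_le_iff)
    then have "real (q - d) * \<beta> ^ d < real q * (1 + - (1 / (real q + 1))) ^ d * \<beta> ^ d"
      using \<beta> by (intro mult_strict_right_mono) auto
    also have "\<dots> = real q * ((1 + - (1 / (real q + 1))) * \<beta>) ^ d" by (simp only: power_mult_distrib mult.assoc)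
    also have "\<dots> = real q" unfolding inv by simp
    finally show ?thesis .
  qed
  have upm: "real m * \<beta> ^ q \<le> real q * \<beta> ^ m" if "q \<le> m"
  proof -
    have "real m * \<beta> ^ q \<le> real q * \<beta> ^ (m - q) * \<beta> ^ q" using up[of "m - q"] that \<beta> by (intro mult_right_mono) auto
    also have "\<dots> = real q * \<beta> ^ m" using that by (simp add: power_add[symmetric] mult.assoc)
    finally show ?thesis .
  qed
  have upm': "real m * \<beta> ^ q < real q * \<beta> ^ m" if "q + 1 < m"
  proof -
    have "Suc (m - q - 1) = m - q" "m - q - 1 \<ge> 1" using that by auto
    then have "real m < real q * \<beta> ^ (m - q)" using up'[of "m - q - 1"] that by simp
    then have "real m * \<beta> ^ q < real q * \<beta> ^ (m - q) * \<beta> ^ q" using \<beta> by (intro mult_strict_right_mono) auto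
    also have "\<dots> = real q * \<beta> ^ m" using that by (simp add: power_add[symmetric] mult.assoc)
    finally show ?thesis .
  qed
  have downm: "real m * \<beta> ^ q < real q * \<beta> ^ m" if "m < q"
  proof -
    have "real m * \<beta> ^ (q - m) < real q" using down[of "q - m"] that by simp
    then have "real m * \<beta> ^ (q - m) * \<beta> ^ m < real q * \<beta> ^ m" using \<beta> by (intro mult_strict_right_mono) auto
    then show ?thesis using that by (simp add: power_add[symmetric] mult.assoc)
  qed
  show "real m * \<beta> ^ q \<le> real q * \<beta> ^ m" using upm downm by (cases "q \<le> m") auto
  show "m \<noteq> q \<Longrightarrow> m \<noteq> q + 1 \<Longrightarrow> real m * \<beta> ^ q < real q * \<beta> ^ m"
    using upm' downm by (cases "q + 1 < m") auto
qed

lemma prod_le_prod_balanced: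
  fixes m t :: "nat \<Rightarrow> nat"
  assumes q: "q \<ge> 1" and t: "\<And>j. j < s \<Longrightarrow> t j = q \<or> t j = q + 1"
    and le: "(\<Sum>j<s. m j) \<le> (\<Sum>j<s. t j)"
  shows "(\<Prod>j<s. m j) \<le> (\<Prod>j<s. t j)"
    and "(\<Prod>j<s. m j) = (\<Prod>j<s. t j) \<Longrightarrow>
      (\<Sum>j<s. m j) = (\<Sum>j<s. t j) \<and> (\<forall>j<s. m j = q \<or> m j = q + 1)"
proof -
  define \<beta> where "\<beta> = 1 + 1 / real q"
  have \<beta>: "\<beta> > 1" using q by (simp add: \<beta>_def)
  have split: "(\<Prod>j<s. real q * \<beta> ^ f j) = real q ^ s * \<beta> ^ (\<Sum>j<s. f j)" for f
    by (simp add: prod.distrib power_sum)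
  have tj: "real (t j) * \<beta> ^ q = real q * \<beta> ^ t j" if "j < s" for j
    using t[OF that] q by (auto simp: \<beta>_def field_simps)
  have T: "(\<Prod>j<s. real (t j) * \<beta> ^ q) = real q ^ s * \<beta> ^ (\<Sum>j<s. t j)"
    unfolding split[symmetric] by (intro prod.cong) (auto simp: tj)
  have mle: "real (m j) * \<beta> ^ q \<le> real q * \<beta> ^ m j" for j
    unfolding \<beta>_def by (rule balanced_exponential_bound(1)[OF q])
  have 1: "(\<Prod>j<s. real (m j) * \<beta> ^ q) \<le> real q ^ s * \<beta> ^ (\<Sum>j<s. m j)"
    unfolding split[symmetric] by (intro prod_mono conjI mle) (use \<beta> in auto)
  have 2: "real q ^ s * \<beta> ^ (\<Sum>j<s. m j) \<le> real q ^ s * \<beta> ^ (\<Sum>j<s. t j)"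
    using \<beta> le by (intro mult_left_mono power_increasing) auto
  have \<beta>q: "(\<beta> ^ q) ^ s > 0" using \<beta> by simp
  have prods: "(\<Prod>j<s. real (f j) * \<beta> ^ q) = real (\<Prod>j<s. f j) * (\<beta> ^ q) ^ s" for f :: "nat \<Rightarrow> nat"
    by (simp add: prod.distrib)
  have "real (\<Prod>j<s. m j) * (\<beta> ^ q) ^ s \<le> real (\<Prod>j<s. t j) * (\<beta> ^ q) ^ s"
    using 1 2 T unfolding prods by linarith
  then have "real (\<Prod>j<s. m j) \<le> real (\<Prod>j<s. t j)" using \<beta>q by (rule mult_right_le_imp_le)
  then show "(\<Prod>j<s. m j) \<le> (\<Prod>j<s. t j)" by (simp only: of_nat_le_iff)
  assume eq: "(\<Prod>j<s. m j) = (\<Prod>j<s. t j)"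
  have "(\<Prod>j<s. real (m j) * \<beta> ^ q) = (\<Prod>j<s. real (t j) * \<beta> ^ q)" unfolding prods eq ..
  then have e2: "real q ^ s * \<beta> ^ (\<Sum>j<s. m j) = real q ^ s * \<beta> ^ (\<Sum>j<s. t j)"
    and e1: "(\<Prod>j<s. real (m j) * \<beta> ^ q) = (\<Prod>j<s. real q * \<beta> ^ m j)"
    using 1 2 T unfolding split by linarith+
  have "(\<Sum>j<s. m j) = (\<Sum>j<s. t j)"
    using e2 q \<beta> by (simp add: power_inject_exp)
  moreover have "m j = q \<or> m j = q + 1" if j: "j < s" for j
  proof (rule ccontr)
    assume "\<not> (m j = q \<or> m j = q + 1)"
    then have lt: "real (m j) * \<beta> ^ q < real q * \<beta> ^ m j"
      using balanced_exponential_bound(2)[OF q, of "m j"] by (simp add: \<beta>_def)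
    have "(\<Prod>i<s. real (m i) * \<beta> ^ q) = real (m j) * \<beta> ^ q * (\<Prod>i\<in>{..<s} - {j}. real (m i) * \<beta> ^ q)"
      using j by (intro prod.remove) auto
    also have "\<dots> \<le> real (m j) * \<beta> ^ q * (\<Prod>i\<in>{..<s} - {j}. real q * \<beta> ^ m i)"
      using \<beta> mle by (intro mult_left_mono prod_mono) auto
    also have "\<dots> < real q * \<beta> ^ m j * (\<Prod>i\<in>{..<s} - {j}. real q * \<beta> ^ m i)"
      using lt \<beta> q by (intro mult_strict_right_mono prod_pos) auto
    also have "\<dots> = (\<Prod>i<s. real q * \<beta> ^ m i)"
      using j by (intro prod.remove[symmetric]) auto
    finally show False using e1 by simp
  qed
  ultimately show "(\<Sum>j<s. m j) = (\<Sum>j<s. t j) \<and> (\<forall>j<s. m j = q \<or> m j = q + 1)" by blast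
qed

text \<open>Two families of sizes in \<open>{q, q + 1}\<close> with the same sum take the value \<open>q + 1\<close> equally often.\<close>

lemma two_valued_rearrangement:
  fixes m t :: "nat \<Rightarrow> nat"
  assumes t: "\<And>j. j < s \<Longrightarrow> t j = q \<or> t j = q + 1" and m: "\<And>j. j < s \<Longrightarrow> m j = q \<or> m j = q + 1"
    and eq: "(\<Sum>j<s. m j) = (\<Sum>j<s. t j)"
  obtains \<pi> where "bij_betw \<pi> {..<s} {..<s}" "\<And>j. j < s \<Longrightarrow> t (\<pi> j) = m j"
proof -
  have count: "(\<Sum>j<s. f j) = s * q + card {j \<in> {..<s}. f j = q + 1}"
    if "\<And>j. j < s \<Longrightarrow> f j = q \<or> f j = q + 1" for f :: "nat \<Rightarrow> nat"
  proof -
    have "(\<Sum>j<s. f j) = (\<Sum>j<s. q + (if f j = q + 1 then 1 else 0))"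
      by (intro sum.cong) (use that in auto)
    then show ?thesis by (simp add: sum.distrib sum.If_cases Int_def conj_commute)
  qed
  define M1 T1 where "M1 = {j \<in> {..<s}. m j = q + 1}" and "T1 = {j \<in> {..<s}. t j = q + 1}"
  have c1: "card M1 = card T1" using count[OF t] count[OF m] eq by (simp add: M1_def T1_def)
  have sub: "M1 \<subseteq> {..<s}" "T1 \<subseteq> {..<s}" by (auto simp: M1_def T1_def)
  have fins: "finite M1" "finite T1" using sub finite_subset by blast+
  have c2: "card ({..<s} - M1) = card ({..<s} - T1)" using c1 sub fins by (simp add: card_Diff_subset)
  obtain f where f: "bij_betw f M1 T1" using finite_same_card_bij[OF fins c1] by blast
  obtain g where g: "bij_betw g ({..<s} - M1) ({..<s} - T1)" using finite_same_card_bij[OF _ _ c2] by auto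
  define p where "p = (\<lambda>j. if j \<in> M1 then f j else g j)"
  have p1: "bij_betw p M1 T1" using f by (rule bij_betw_cong[THEN iffD1, rotated]) (simp add: p_def)
  have p2: "bij_betw p ({..<s} - M1) ({..<s} - T1)"
    using g by (rule bij_betw_cong[THEN iffD1, rotated]) (simp add: p_def)
  have "bij_betw p (M1 \<union> ({..<s} - M1)) (T1 \<union> ({..<s} - T1))"
    by (rule bij_betw_combine[OF p1 p2]) auto
  moreover have "M1 \<union> ({..<s} - M1) = {..<s}" "T1 \<union> ({..<s} - T1) = {..<s}" using sub by auto
  ultimately have bp: "bij_betw p {..<s} {..<s}" by simp
  have "t (p j) = m j" if j: "j < s" for j
  proof (cases "j \<in> M1")
    case True
    then have "p j \<in> T1" using p1 bij_betwE by blast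
    with True show ?thesis by (simp add: M1_def T1_def)
  next
    case False
    then have "p j \<in> {..<s} - T1" using p2 j bij_betwE by (metis DiffI lessThan_iff)
    with False show ?thesis using m[OF j] t[of "p j"] j by (auto simp: M1_def T1_def)
  qed
  with bp that show thesis by blast
qed

lemma bij_between_colour_classes:
  assumes fin: "finite X" "finite Y" and bij: "bij_betw \<pi> I J"
    and c: "\<And>x. x \<in> X \<Longrightarrow> c x \<in> I" and d: "\<And>y. y \<in> Y \<Longrightarrow> d y \<in> J"
    and card: "\<And>i. i \<in> I \<Longrightarrow> card {x \<in> X. c x = i} = card {y \<in> Y. d y = \<pi> i}"
  obtains f where "bij_betw f X Y" "\<And>x. x \<in> X \<Longrightarrow> d (f x) = \<pi> (c x)"
proof -
  have "\<exists>f. bij_betw f {x \<in> X. c x = i} {y \<in> Y. d y = \<pi> i}" if "i \<in> I" for i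
    using card[OF that] fin by (intro finite_same_card_bij) auto
  then obtain f where f: "\<And>i. i \<in> I \<Longrightarrow> bij_betw (f i) {x \<in> X. c x = i} {y \<in> Y. d y = \<pi> i}"
    by metis
  let ?f = "\<lambda>x. f (c x) x"
  have val: "?f x \<in> Y \<and> d (?f x) = \<pi> (c x)" if "x \<in> X" for x
    using bij_betwE[OF f[OF c[OF that]]] that by auto
  have "inj_on ?f X"
  proof (rule inj_onI)
    fix x y assume xy: "x \<in> X" "y \<in> X" "?f x = ?f y"
    then have "\<pi> (c x) = \<pi> (c y)" using val by metis
    then have "c x = c y" using bij c xy by (meson bij_betw_def inj_onD)
    with xy f[OF c[OF xy(1)]] show "x = y" unfolding bij_betw_def inj_on_def by auto
  qed
  moreover have "Y \<subseteq> ?f ` X"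
  proof
    fix y assume y: "y \<in> Y"
    then obtain i where i: "i \<in> I" "d y = \<pi> i" using bij d by (metis bij_betw_def imageE)
    then have "y \<in> f i ` {x \<in> X. c x = i}" using f[OF i(1)] y unfolding bij_betw_def by auto
    then show "y \<in> ?f ` X" by auto
  qed
  ultimately have "bij_betw ?f X Y" using val by (auto simp: bij_betw_def)
  with that val show thesis by blast
qed

section \<open>The extremal graph\<close>

definition core_turan_graph :: "nat \<Rightarrow> nat \<Rightarrow> nat \<Rightarrow> (nat + nat) graph" where
  "core_turan_graph a s m = graph_join (complete_graph a) (turan_graph s m)"

lemma verts_core_turan_graph:
  "verts (core_turan_graph a s m) = {..<a} <+> (if s = 0 then {} else {..<m})"
  by (simp add: core_turan_graph_def graph_join_def disjoint_union_def complete_graph_def turan_graph_def)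

lemma finite_verts_core_turan_graph: "finite (verts (core_turan_graph a s m))"
  by (simp add: verts_core_turan_graph)

lemma image_doubletons:
  "(\<lambda>e. f ` e) ` {{u, v} |u v. P u v} = {{f u, f v} |u v. P u v}"
proof -
  have "(\<lambda>e. f ` e) ` {{u, v} |u v. P u v} = {f ` {u, v} |u v. P u v}" by blast
  then show ?thesis by simp
qed

lemma edges_core_turan_graph:
  "{Inl u, Inl v} \<in> edges (core_turan_graph a s m) \<longleftrightarrow> u < a \<and> v < a \<and> u \<noteq> v"
  "{Inl u, Inr v} \<in> edges (core_turan_graph a s m) \<longleftrightarrow> u < a \<and> 0 < s \<and> v < m"
  "{Inr v, Inl u} \<in> edges (core_turan_graph a s m) \<longleftrightarrow> u < a \<and> 0 < s \<and> v < m"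
  "{Inr u, Inr v} \<in> edges (core_turan_graph a s m) \<longleftrightarrow> 0 < s \<and> u < m \<and> v < m \<and> u mod s \<noteq> v mod s"
proof -
  have "edges (core_turan_graph a s m) = {{Inl u, Inl v} |u v. u < a \<and> v < a \<and> u \<noteq> v}
      \<union> {{Inr u, Inr v} |u v. 0 < s \<and> u < m \<and> v < m \<and> u mod s \<noteq> v mod s}
      \<union> {{Inl u, Inr v} |u v. u < a \<and> 0 < s \<and> v < m}"
    by (cases "s = 0") (simp_all add: core_turan_graph_def graph_join_def disjoint_union_def
        complete_graph_def turan_graph_def image_doubletons)
  then show "{Inl u, Inl v} \<in> edges (core_turan_graph a s m) \<longleftrightarrow> u < a \<and> v < a \<and> u \<noteq> v"
    "{Inl u, Inr v} \<in> edges (core_turan_graph a s m) \<longleftrightarrow> u < a \<and> 0 < s \<and> v < m"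
    "{Inr v, Inl u} \<in> edges (core_turan_graph a s m) \<longleftrightarrow> u < a \<and> 0 < s \<and> v < m"
    "{Inr u, Inr v} \<in> edges (core_turan_graph a s m) \<longleftrightarrow> 0 < s \<and> u < m \<and> v < m \<and> u mod s \<noteq> v mod s"
    by (auto simp: doubleton_eq_iff)
qed

abbreviation residue_class :: "nat \<Rightarrow> nat \<Rightarrow> nat \<Rightarrow> nat set" where
  "residue_class s m j \<equiv> {v. v < m \<and> v mod s = j}"

text \<open>The test vector has entry \<open>1\<close> on the core and distributes the \<open>k\<close>-th power mass \<open>1\<close> evenly
  over each part.\<close>

lemma clique_spectral_radius_core_turan_ge:
  assumes s: "s \<ge> 1" and a: "a \<ge> 1" and m: "s \<le> m"
  shows "real (\<Prod>j<s. card (residue_class s m j)) ^ (a + s - 1)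
     \<le> clique_spectral_radius (a + s) (core_turan_graph a s m) ^ (a + s)"
proof -
  let ?E = "core_turan_graph a s m" and ?R = "residue_class s m" and ?k = "a + s"
  define t where "t = (\<lambda>j. real (card (?R j)))"
  define y where "y = (\<lambda>j. root ?k (1 / t j))"
  define x where "x = case_sum (\<lambda>_::nat. 1::real) (\<lambda>v. y (v mod s))"
  have tpos: "0 < t j" if "j < s" for j
  proof -
    have "j \<in> ?R j" using that m by simp
    moreover have "finite (?R j)" by simp
    ultimately show ?thesis unfolding t_def by (metis card_gt_0_iff empty_iff of_nat_0_less_iff)
  qed
  have y0: "0 \<le> y j" for j unfolding y_def by (rule real_root_ge_zero) (simp add: t_def)
  have yk: "y j ^ ?k = 1 / t j" for j unfolding y_def using a by (intro real_root_pow_pos2) (auto simp: t_def)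
  have "(\<Sum>v\<in>verts ?E. x v ^ ?k) = (\<Sum>u<a. 1) + (\<Sum>v<m. y (v mod s) ^ ?k)"
    using s by (simp add: verts_core_turan_graph sum.Plus x_def)
  also have "(\<Sum>v<m. y (v mod s) ^ ?k) = (\<Sum>j<s. \<Sum>v | v \<in> {..<m} \<and> v mod s = j. y (v mod s) ^ ?k)"
    by (rule sum.group[symmetric]) (use s in auto)
  also have "\<dots> = (\<Sum>j<s. 1)"
  proof (rule sum.cong[OF refl])
    fix j assume "j \<in> {..<s}"
    then have "t j * y j ^ ?k = 1" using tpos[of j] by (simp add: yk)
    then show "(\<Sum>v | v \<in> {..<m} \<and> v mod s = j. y (v mod s) ^ ?k) = 1" by (simp add: t_def)
  qed
  finally have norm: "(\<Sum>v\<in>verts ?E. x v ^ ?k) = real ?k" by simp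
  define K where "K = (\<lambda>\<phi>. (Inl ` {..<a} \<union> Inr ` \<phi> ` {..<s} :: (nat + nat) set))"
  let ?P = "PiE {..<s} ?R"
  have \<phi>: "\<phi> j < m" "\<phi> j mod s = j" if "\<phi> \<in> ?P" "j < s" for \<phi> j
    using PiE_mem[OF that(1), of j] that(2) by auto
  have inj\<phi>: "inj_on \<phi> {..<s}" if "\<phi> \<in> ?P" for \<phi>
    using \<phi>(2)[OF that] by (intro inj_on_inverseI[where g = "\<lambda>v. v mod s"]) auto
  have KC: "K \<phi> \<in> cliques ?k ?E" if p: "\<phi> \<in> ?P" for \<phi>
  proof -
    have "card (K \<phi>) = card (Inl ` {..<a} :: (nat + nat) set) + card (Inr ` \<phi> ` {..<s} :: (nat + nat) set)"
      unfolding K_def by (rule card_Un_disjoint) auto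
    also have "\<dots> = ?k" using inj\<phi>[OF p] by (simp add: card_image)
    finally show ?thesis
      using s \<phi>[OF p]
      by (auto simp: cliques_def K_def verts_core_turan_graph edges_core_turan_graph)
  qed
  have injK: "inj_on K ?P"
  proof (rule inj_onI)
    fix \<phi> \<psi> assume p: "\<phi> \<in> ?P" "\<psi> \<in> ?P" and eq: "K \<phi> = K \<psi>"
    show "\<phi> = \<psi>"
    proof (rule PiE_ext[OF p])
      fix j assume j: "j \<in> {..<s}"
      then have "Inr (\<phi> j) \<in> K \<psi>" unfolding eq[symmetric] by (simp add: K_def)
      then obtain i where "i < s" "\<phi> j = \<psi> i" by (auto simp: K_def)
      with \<phi>[OF p(1)] \<phi>[OF p(2)] j show "\<phi> j = \<psi> j" by (metis lessThan_iff)
    qed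
  qed
  have "(\<Prod>j<s. t j * y j) = (\<Prod>j<s. \<Sum>v\<in>?R j. y j)" by (simp add: t_def)
  also have "\<dots> = (\<Sum>\<phi>\<in>?P. \<Prod>j<s. y j)" by (rule prod_sum_PiE) auto
  also have "\<dots> = (\<Sum>\<phi>\<in>?P. \<Prod>v\<in>K \<phi>. x v)"
  proof (rule sum.cong[OF refl])
    fix \<phi> assume p: "\<phi> \<in> ?P"
    have "(\<Prod>v\<in>K \<phi>. x v) = (\<Prod>v\<in>Inl ` {..<a}. x v) * (\<Prod>v\<in>Inr ` \<phi> ` {..<s}. x v)"
      unfolding K_def by (rule prod.union_disjoint) auto
    also have "(\<Prod>v\<in>Inl ` {..<a}. x v) = 1" by (rule prod.neutral) (auto simp: x_def)
    also have "(\<Prod>v\<in>Inr ` \<phi> ` {..<s}. x v) = (\<Prod>j<s. y j)"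
      using inj\<phi>[OF p] \<phi>(2)[OF p] by (simp add: prod.reindex x_def)
    finally show "(\<Prod>j<s. y j) = (\<Prod>v\<in>K \<phi>. x v)" by simp
  qed
  also have "\<dots> = (\<Sum>S\<in>K ` ?P. \<Prod>v\<in>S. x v)" by (simp add: sum.reindex[OF injK])
  also have "\<dots> \<le> clique_poly ?k ?E x"
    using KC y0 by (intro clique_poly_mono finite_verts_core_turan_graph) (auto simp: x_def split: sum.split)
  finally have "real ?k * (\<Prod>j<s. t j * y j) \<le> real ?k * clique_poly ?k ?E x"
    by (rule mult_left_mono) simp
  also have "\<dots> \<le> clique_spectral_radius ?k ?E * (\<Sum>v\<in>verts ?E. x v ^ ?k)"
  proof (rule clique_spectral_radius_ge[OF finite_verts_core_turan_graph])
    have "Inl 0 \<in> verts ?E" using a by (auto simp: verts_core_turan_graph)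
    then show "verts ?E \<noteq> {}" by blast
  qed (use a s y0 in \<open>auto simp: x_def split: sum.split\<close>)
  finally have "(\<Prod>j<s. t j * y j) \<le> clique_spectral_radius ?k ?E"
    using a by (simp add: norm mult.commute)
  moreover have "0 \<le> (\<Prod>j<s. t j * y j)" by (intro prod_nonneg) (auto simp: t_def y0)
  ultimately have "(\<Prod>j<s. t j * y j) ^ ?k \<le> clique_spectral_radius ?k ?E ^ ?k" by (rule power_mono)
  moreover have "(\<Prod>j<s. t j * y j) ^ ?k = (\<Prod>j<s. t j ^ (?k - 1))"
    unfolding prod_power_distrib
  proof (rule prod.cong[OF refl])
    fix j assume "j \<in> {..<s}"
    then have "t j > 0" using tpos by simp
    moreover have "t j ^ ?k = t j * t j ^ (?k - 1)" using a by (simp add: power_eq_if)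
    ultimately show "(t j * y j) ^ ?k = t j ^ (?k - 1)" by (simp add: power_mult_distrib yk)
  qed
  ultimately show ?thesis by (simp add: t_def prod_power_distrib)
qed

lemma clique_spectral_radius_complete:
  assumes "k \<ge> 2"
  shows "clique_spectral_radius k (core_turan_graph k 0 m) = 1"
proof -
  let ?E = "core_turan_graph k 0 m"
  have V: "verts ?E = Inl ` {..<k}" by (auto simp: verts_core_turan_graph Plus_def)
  then have cV: "card (verts ?E) = k" "finite (verts ?E)" by (simp_all add: card_image)
  have all: "verts ?E \<in> cliques k ?E"
    using cV by (auto simp: cliques_def V edges_core_turan_graph)
  have "cliques k ?E = {verts ?E}"
    using all cV card_subset_eq[OF cV(2)] by (auto simp: cliques_def)
  moreover have "cliques (Suc k) ?E = {}"
  proof (rule ccontr)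
    assume "cliques (Suc k) ?E \<noteq> {}"
    then obtain Q where "Q \<in> cliques (Suc k) ?E" by blast
    then have "card Q = Suc k" "Q \<subseteq> verts ?E" using cliquesD by blast+
    with card_mono[OF cV(2), of Q] cV(1) show False by simp
  qed
  moreover have ne: "verts ?E \<noteq> {}" using cV assms by auto
  ultimately have "clique_spectral_radius k ?E ^ k \<le> 1"
    using clique_spectral_radius_power_le_card[OF cV(2) ne assms] by simp
  then have "clique_spectral_radius k ?E \<le> 1"
    using clique_spectral_radius_nonneg[OF cV(2) ne assms] assms
    by (metis linorder_not_less one_less_power order.strict_trans2 zero_less_numeral)
  with clique_spectral_radius_ge_1[OF cV(2) assms all] show ?thesis by simp
qed

section \<open>Invariance under isomorphism\<close>

lemma graph_iso_sym:
  assumes "graph_iso G H"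
  shows "graph_iso H G"
proof -
  obtain f where f: "bij_betw f (verts G) (verts H)"
    and e: "\<And>u v. u \<in> verts G \<Longrightarrow> v \<in> verts G \<Longrightarrow> {u, v} \<in> edges G \<longleftrightarrow> {f u, f v} \<in> edges H"
    using assms unfolding graph_iso_def by blast
  let ?g = "inv_into (verts G) f"
  have g: "?g w \<in> verts G" "f (?g w) = w" if "w \<in> verts H" for w
    using f that by (auto simp: bij_betw_def inv_into_into f_inv_into_f)
  have "bij_betw ?g (verts H) (verts G)" using f by (rule bij_betw_inv_into)
  with e g show ?thesis unfolding graph_iso_def by (intro exI[of _ ?g]) auto
qed

text \<open>An isomorphism transports a maximiser for \<open>G\<close> to a test vector for \<open>H\<close>.\<close>

lemma clique_spectral_radius_iso_le:
  assumes iso: "graph_iso G H" and fin: "finite (verts G)" "verts G \<noteq> {}" and k: "k \<ge> 2"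
  shows "clique_spectral_radius k G \<le> clique_spectral_radius k H"
proof -
  obtain f where f: "bij_betw f (verts G) (verts H)"
    and e: "\<And>u v. u \<in> verts G \<Longrightarrow> v \<in> verts G \<Longrightarrow> {u, v} \<in> edges G \<longleftrightarrow> {f u, f v} \<in> edges H"
    using iso unfolding graph_iso_def by blast
  have inj: "inj_on f (verts G)" and im: "f ` verts G = verts H" using f by (auto simp: bij_betw_def)
  have finH: "finite (verts H)" "verts H \<noteq> {}" using fin im finite_imageI[OF fin(1), of f] by auto
  obtain x where x: "\<And>v. 0 \<le> x v" "(\<Sum>v\<in>verts G. x v ^ k) = 1"
    and mu: "clique_spectral_radius k G = k * clique_poly k G x"
    using clique_spectral_radius_variational[OF fin k] by metis
  let ?y = "\<lambda>w. x (inv_into (verts G) f w)"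
  have yf: "?y (f v) = x v" if "v \<in> verts G" for v using that inj by simp
  have "clique_poly k G x = (\<Sum>K\<in>cliques k G. \<Prod>w\<in>f ` K. ?y w)"
    unfolding clique_poly_def
  proof (rule sum.cong[OF refl])
    fix K assume K: "K \<in> cliques k G"
    have "inj_on f K" by (rule inj_on_subset[OF inj cliquesD(1)[OF K]])
    then have "(\<Prod>w\<in>f ` K. ?y w) = (\<Prod>v\<in>K. ?y (f v))" by (simp only: prod.reindex o_def)
    also have "\<dots> = (\<Prod>v\<in>K. x v)" by (intro prod.cong refl yf) (use cliquesD(1)[OF K] in blast)
    finally show "(\<Prod>v\<in>K. x v) = (\<Prod>w\<in>f ` K. ?y w)" by (rule sym)
  qed
  also have "\<dots> = (\<Sum>L\<in>image f ` cliques k G. \<Prod>w\<in>L. ?y w)"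
  proof -
    have "inj_on (image f) (cliques k G)"
      using inj_on_image_Pow[OF inj] by (rule inj_on_subset) (auto dest: cliquesD(1))
    then show ?thesis by (simp add: sum.reindex)
  qed
  also have "\<dots> \<le> clique_poly k H ?y"
  proof (rule clique_poly_mono[OF finH(1)])
    show "image f ` cliques k G \<subseteq> cliques k H"
    proof
      fix L assume "L \<in> image f ` cliques k G"
      then obtain K where K: "K \<in> cliques k G" "L = f ` K" by blast
      have KV: "K \<subseteq> verts G" by (rule cliquesD(1)[OF K(1)])
      then have "L \<subseteq> verts H" unfolding K(2) im[symmetric] by (rule image_mono)
      moreover have "card L = k"
        using K(2) card_image[OF inj_on_subset[OF inj KV]] cliquesD(3)[OF K(1)] by simp
      moreover have "{f u, f v} \<in> edges H" if "u \<in> K" "v \<in> K" "f u \<noteq> f v" for u v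
        using cliquesD(4)[OF K(1), of u v] e[of u v] that KV by auto
      ultimately show "L \<in> cliques k H"
        using K(2) cliquesD(2)[OF K(1)] by (auto simp: cliques_def)
    qed
  qed (rule x(1))
  finally have "clique_spectral_radius k G \<le> k * clique_poly k H ?y"
    unfolding mu by (rule mult_left_mono) simp
  also have "\<dots> \<le> clique_spectral_radius k H * (\<Sum>w\<in>verts H. ?y w ^ k)"
    by (rule clique_spectral_radius_ge[OF finH k]) (rule x(1))
  also have "(\<Sum>w\<in>verts H. ?y w ^ k) = (\<Sum>v\<in>verts G. x v ^ k)"
    unfolding im[symmetric] by (simp add: sum.reindex[OF inj] yf)
  finally show ?thesis by (simp add: x(2))
qed

section \<open>Graphs whose large cliques share a core\<close>

text \<open>Removing from a \<open>(k+1)\<close>-clique the common vertex, or any vertex if the common one is absent,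
  leaves a \<open>k\<close>-clique that misses the common vertex.\<close>

lemma no_larger_clique:
  assumes core: "\<And>K. K \<in> cliques k G \<Longrightarrow> x \<in> K" and k: "k \<ge> 1"
  shows "cliques (Suc k) G = {}"
proof (rule ccontr)
  assume "cliques (Suc k) G \<noteq> {}"
  then obtain Q where Q: "Q \<in> cliques (Suc k) G" by blast
  have sub: "Q - {y} \<in> cliques k G" if "y \<in> Q" for y
    using Q that by (auto simp: cliques_def)
  have "Q \<noteq> {}" using cliquesD(3)[OF Q] by auto
  then obtain y where "y \<in> Q" by blast
  then show False using sub[of x] sub[of y] core by blast
qed

lemma cliques_through_core:
  assumes A: "A \<in> cliques a G" and core: "\<And>K. K \<in> cliques (a + s) G \<Longrightarrow> A \<subseteq> K"
  defines "N \<equiv> {x \<in> verts G - A. \<forall>u\<in>A. {u, x} \<in> edges G}"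
  shows "card (cliques (a + s) G) = card (cliques s (Graph N (edges G)))"
    and "a \<ge> 1 \<Longrightarrow> cliques (Suc s) (Graph N (edges G)) = {}"
proof -
  have ext: "A \<union> S \<in> cliques (a + t) G" if S: "S \<in> cliques t (Graph N (edges G))" for S t
  proof -
    have "S \<subseteq> N" using cliquesD(1)[OF S] by simp
    then have "card (A \<union> S) = card A + card S"
      using cliquesD(2)[OF A] cliquesD(2)[OF S] by (intro card_Un_disjoint) (auto simp: N_def)
    moreover have "{u, v} \<in> edges G" if "u \<in> A \<union> S" "v \<in> A \<union> S" "u \<noteq> v" for u v
      using that cliquesD(4)[OF A, of u v] cliquesD(4)[OF S, of u v] \<open>S \<subseteq> N\<close>
      by (auto simp: N_def insert_commute)
    ultimately show ?thesis
      using cliquesD(1-3)[OF A] cliquesD(2,3)[OF S] \<open>S \<subseteq> N\<close>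
      by (auto simp: cliques_def N_def)
  qed
  have "bij_betw ((\<union>) A) (cliques s (Graph N (edges G))) (cliques (a + s) G)"
    unfolding bij_betw_def
  proof (intro conjI equalityI subsetI)
    show "inj_on ((\<union>) A) (cliques s (Graph N (edges G)))"
    proof (rule inj_onI)
      fix S T assume "S \<in> cliques s (Graph N (edges G))" "T \<in> cliques s (Graph N (edges G))" "A \<union> S = A \<union> T"
      moreover from this have "S \<inter> A = {}" "T \<inter> A = {}" using cliquesD(1) by (fastforce simp: N_def)+
      ultimately show "S = T" by blast
    qed
  next
    fix K assume "K \<in> (\<union>) A ` cliques s (Graph N (edges G))"
    then show "K \<in> cliques (a + s) G" using ext by blast
  next
    fix K assume K: "K \<in> cliques (a + s) G"
    have AK: "A \<subseteq> K" using core[OF K] .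
    have "card (K - A) = s"
      using cliquesD(3)[OF K] cliquesD(2,3)[OF A] AK by (simp add: card_Diff_subset)
    moreover have "K - A \<subseteq> N"
      using cliquesD(1,4)[OF K] AK by (auto simp: N_def)
    ultimately have "K - A \<in> cliques s (Graph N (edges G))"
      using K by (auto simp: cliques_def)
    moreover have "K = A \<union> (K - A)" using AK by blast
    ultimately show "K \<in> (\<union>) A ` cliques s (Graph N (edges G))" by blast
  qed
  then show "card (cliques (a + s) G) = card (cliques s (Graph N (edges G)))"
    by (metis bij_betw_same_card)
  assume a: "a \<ge> 1"
  then obtain x where "x \<in> A" using cliquesD(3)[OF A] by fastforce
  then have "cliques (Suc (a + s)) G = {}"
    using core a by (intro no_larger_clique[of _ _ x]) auto
  then show "cliques (Suc s) (Graph N (edges G)) = {}" using ext[of _ "Suc s"] by fastforce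
qed

text \<open>An isomorphism is assembled from bijections between colour classes and residue classes of equal
  size; \<open>\<pi>\<close> tells which residue class a colour is sent to.\<close>

lemma iso_core_turan_graph:
  assumes G: "simple_graph G" and A: "A \<subseteq> verts G" "card A = a" and s: "s \<ge> 1"
    and c: "\<And>v. v \<in> verts G - A \<Longrightarrow> c v < s"
    and \<pi>: "bij_betw \<pi> {..<s} {..<s}"
    and sizes: "\<And>j. j < s \<Longrightarrow> card {v \<in> verts G - A. c v = j} = card (residue_class s m (\<pi> j))"
    and adj: "\<And>u v. u \<in> verts G \<Longrightarrow> v \<in> verts G \<Longrightarrow>
      {u, v} \<in> edges G \<longleftrightarrow> u \<noteq> v \<and> (u \<in> A \<or> v \<in> A \<or> c u \<noteq> c v)"
  shows "graph_iso G (core_turan_graph a s m)"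
proof -
  have fin: "finite (verts G)" using G by (simp add: simple_graph_def)
  then have finA: "finite A" using A finite_subset by blast
  obtain g where g: "bij_betw g A {..<a}"
    using ex_bij_betw_finite_nat[OF finA] A(2) by (auto simp: atLeast0LessThan)
  obtain f where f: "bij_betw f (verts G - A) {..<m}"
    and fc: "\<And>v. v \<in> verts G - A \<Longrightarrow> f v mod s = \<pi> (c v)"
  proof (rule bij_between_colour_classes[OF _ _ \<pi>])
    show "card {v \<in> verts G - A. c v = i} = card {y \<in> {..<m}. y mod s = \<pi> i}" if "i \<in> {..<s}" for i
      using sizes[of i] that by simp
  qed (use fin c s in auto)
  let ?h = "\<lambda>v. if v \<in> A then Inl (g v) else Inr (f v)"
  have gA: "g ` A = {..<a}" "inj_on g A" and fA: "f ` (verts G - A) = {..<m}" "inj_on f (verts G - A)"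
    using f g by (auto simp: bij_betw_def)
  have "inj_on ?h (verts G)" using gA(2) fA(2) by (auto simp: inj_on_def)
  moreover have "?h ` verts G = {..<a} <+> {..<m}"
  proof -
    have "?h ` verts G = ?h ` A \<union> ?h ` (verts G - A)" using A by blast
    also have "?h ` A = Inl ` g ` A" by (auto simp: image_image)
    also have "?h ` (verts G - A) = Inr ` f ` (verts G - A)" by (auto simp: image_image)
    finally show ?thesis unfolding gA(1) fA(1) by (simp add: Plus_def)
  qed
  ultimately have bij: "bij_betw ?h (verts G) (verts (core_turan_graph a s m))"
    using s by (simp add: bij_betw_def verts_core_turan_graph)
  have ge: "g v < a" if "v \<in> A" for v using gA(1) that by blast
  have fe: "f v < m" if "v \<in> verts G - A" for v using fA(1) that by blast
  have gi: "g u = g v \<longleftrightarrow> u = v" if "u \<in> A" "v \<in> A" for u v using gA(2) that by (auto dest: inj_onD)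
  have col: "f u mod s = f v mod s \<longleftrightarrow> c u = c v" if "u \<in> verts G - A" "v \<in> verts G - A" for u v
    using fc[OF that(1)] fc[OF that(2)] c[OF that(1)] c[OF that(2)] \<pi>
    by (metis bij_betw_def inj_on_eq_iff lessThan_iff)
  have "{u, v} \<in> edges G \<longleftrightarrow> {?h u, ?h v} \<in> edges (core_turan_graph a s m)"
    if uv: "u \<in> verts G" "v \<in> verts G" for u v
    using uv s ge[of u] ge[of v] fe[of u] fe[of v] gi[of u v] col[of u v]
    unfolding adj[OF uv] by (cases "u \<in> A"; cases "v \<in> A") (auto simp: edges_core_turan_graph)
  with bij show ?thesis unfolding graph_iso_def by blast
qed

text \<open>The colouring of \<open>weighted_zykov\<close> bounds the number of cliques by a product of part sizes whose
  sum is at most \<open>m\<close>. In the case of equality the parts are balanced and exhaust all vertices outside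
  \<open>A\<close>, vertices of different colours are adjacent, and an edge inside a part would extend to an
  \<open>(s+1)\<close>-clique of the link of \<open>A\<close>.\<close>

theorem card_cliques_with_core:
  assumes G: "simple_graph G" and a: "a \<ge> 1" and s: "s \<ge> 1"
    and A: "card A = a" and core: "\<And>K. K \<in> cliques (a + s) G \<Longrightarrow> A \<subseteq> K"
    and m: "m = card (verts G) - a" "s \<le> m"
  shows "card (cliques (a + s) G) \<le> (\<Prod>j<s. card (residue_class s m j))"
    and "card (cliques (a + s) G) = (\<Prod>j<s. card (residue_class s m j)) \<Longrightarrow>
      graph_iso G (core_turan_graph a s m)"
proof -
  let ?t = "\<lambda>j. card (residue_class s m j)" and ?E = "edges G" and ?V = "verts G"
  define q where "q = m div s"
  have q: "q \<ge> 1" using m(2) s by (simp add: q_def div_greater_zero_iff Suc_le_eq)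
  have t: "?t j = q \<or> ?t j = q + 1" if "j < s" for j using card_residue_class[OF that, of m] by (simp add: q_def)
  have "0 < ?t j" if "j < s" for j using t[OF that] q by auto
  then have tpos: "0 < (\<Prod>j<s. ?t j)" by (intro prod_pos) auto
  have fin: "finite ?V" using G by (simp add: simple_graph_def)
  have "card (cliques (a + s) G) \<le> (\<Prod>j<s. ?t j) \<and>
    (card (cliques (a + s) G) = (\<Prod>j<s. ?t j) \<longrightarrow> graph_iso G (core_turan_graph a s m))"
  proof (cases "cliques (a + s) G = {}")
    case True
    then have none: "card (cliques (a + s) G) = 0" by simp
    show ?thesis unfolding none using tpos by (intro conjI impI) linarith+
  next
    case False
    then obtain K0 where K0: "K0 \<in> cliques (a + s) G" by blast
    have finA: "finite A" using A a card_gt_0_iff by fastforce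
    have Acl: "A \<in> cliques a G"
      using K0 core[OF K0] A finA by (auto simp: cliques_def)
    define N where "N = {x \<in> ?V - A. \<forall>u\<in>A. {u, x} \<in> ?E}"
    have cardN: "card (cliques (a + s) G) = card (cliques s (Graph N ?E))"
      and freeN: "cliques (Suc s) (Graph N ?E) = {}"
      using cliques_through_core[OF Acl core] a unfolding N_def by blast+
    have finN: "finite N" and NV: "N \<subseteq> ?V - A" using fin by (auto simp: N_def)
    obtain c where c: "\<forall>v\<in>N. c v < s"
      and cle: "clique_poly s (Graph N ?E) (\<lambda>_. 1) \<le> (\<Prod>j<s. \<Sum>v | v \<in> N \<and> c v = j. 1)"
      and ceq: "clique_poly s (Graph N ?E) (\<lambda>_. 1) = (\<Prod>j<s. \<Sum>v | v \<in> N \<and> c v = j. 1) \<Longrightarrow>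
        \<forall>j<s. \<exists>v\<in>N. c v = j \<Longrightarrow> \<forall>u\<in>N. \<forall>v\<in>N. c u \<noteq> c v \<longrightarrow> {u, v} \<in> ?E"
      using weighted_zykov[OF finN freeN, of "\<lambda>_. 1"] by auto
    define p where "p = (\<lambda>j. card {v \<in> N. c v = j})"
    have poly: "clique_poly s (Graph N ?E) (\<lambda>_. 1) = real (card (cliques s (Graph N ?E)))"
      by (simp add: clique_poly_def)
    have parts: "(\<Prod>j<s. \<Sum>v | v \<in> N \<and> c v = j. 1) = real (\<Prod>j<s. p j)" by (simp add: p_def)
    have Np: "card (cliques s (Graph N ?E)) \<le> (\<Prod>j<s. p j)"
      using cle unfolding poly parts by (simp only: of_nat_le_iff)
    have "(\<Sum>j<s. \<Sum>v | v \<in> N \<and> c v = j. 1::nat) = (\<Sum>v\<in>N. 1)"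
      by (rule sum.group) (use finN c in auto)
    then have sump: "(\<Sum>j<s. p j) = card N" by (simp add: p_def)
    have "(\<Sum>j<s. \<Sum>v | v \<in> {..<m} \<and> v mod s = j. 1::nat) = (\<Sum>v\<in>{..<m}. 1)"
      by (rule sum.group) (use s in auto)
    then have sumt: "(\<Sum>j<s. ?t j) = m" by simp
    have cW: "card (?V - A) = m"
      using cliquesD(1)[OF Acl] finA A by (simp add: card_Diff_subset m(1))
    have "card N \<le> card (?V - A)" by (rule card_mono) (use fin NV in auto)
    then have sle: "(\<Sum>j<s. p j) \<le> (\<Sum>j<s. ?t j)" unfolding sump sumt cW .
    have pt: "(\<Prod>j<s. p j) \<le> (\<Prod>j<s. ?t j)" by (rule prod_le_prod_balanced(1)[OF q t sle])
    have "graph_iso G (core_turan_graph a s m)" if eq: "card (cliques (a + s) G) = (\<Prod>j<s. ?t j)"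
    proof -
      have eq1: "card (cliques s (Graph N ?E)) = (\<Prod>j<s. p j)" and eq2: "(\<Prod>j<s. p j) = (\<Prod>j<s. ?t j)"
        using eq cardN Np pt by auto
      have bal: "(\<Sum>j<s. p j) = (\<Sum>j<s. ?t j)" "\<And>j. j < s \<Longrightarrow> p j = q \<or> p j = q + 1"
        using prod_le_prod_balanced(2)[OF q t sle eq2] by auto
      have "card N = card (?V - A)" using bal(1) sump sumt cW by simp
      then have NW: "N = ?V - A" using NV fin by (intro card_subset_eq) auto
      have ne: "\<forall>j<s. \<exists>v\<in>N. c v = j"
      proof (intro allI impI)
        fix j assume "j < s"
        then have "p j > 0" using bal(2) q by fastforce
        then have "{v \<in> N. c v = j} \<noteq> {}" unfolding p_def by (metis card.empty less_numeral_extra(3))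
        then show "\<exists>v\<in>N. c v = j" by blast
      qed
      have multi: "\<forall>u\<in>N. \<forall>v\<in>N. c u \<noteq> c v \<longrightarrow> {u, v} \<in> ?E"
        by (rule ceq[OF _ ne]) (simp only: poly parts eq1)
      have indep: "{u, v} \<notin> ?E" if uv: "u \<in> N" "v \<in> N" "u \<noteq> v" "c u = c v" for u v
      proof
        assume e: "{u, v} \<in> ?E"
        obtain S where S: "S \<in> cliques s (Graph N ?E)" "u \<in> S" and uS: "\<And>w. w \<in> S \<Longrightarrow> c w = c u \<Longrightarrow> w = u"
          using transversal_clique[OF finN uv(1) ne c multi] by metis
        have vS: "v \<notin> S" using uS uv by metis
        have "{v, w} \<in> ?E" if "w \<in> S" for w
        proof (cases "w = u")
          case True
          with e show ?thesis by (simp add: insert_commute)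
        next
          case False
          then have "c v \<noteq> c w" using uS that uv(4) by metis
          then show ?thesis using multi uv(2) cliquesD(1)[OF S(1)] that by auto
        qed
        then have "insert v S \<in> cliques (Suc s) (Graph N ?E)"
          using S(1) vS uv(2) by (auto simp: cliques_def insert_commute)
        with freeN show False by blast
      qed
      have loop: "{u} \<notin> ?E" for u using G by (auto simp: simple_graph_def)
      obtain \<pi> where \<pi>: "bij_betw \<pi> {..<s} {..<s}" "\<And>j. j < s \<Longrightarrow> ?t (\<pi> j) = p j"
        using two_valued_rearrangement[of s ?t q p, OF t bal(2) bal(1)] by metis
      show ?thesis
      proof (rule iso_core_turan_graph[OF G cliquesD(1)[OF Acl] A s _ \<pi>(1)])
        show "c v < s" if "v \<in> ?V - A" for v using c that NW by blast
        show "card {v \<in> ?V - A. c v = j} = ?t (\<pi> j)" if "j < s" for j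
          using \<pi>(2)[OF that] by (simp add: p_def NW)
        fix u v assume uv: "u \<in> ?V" "v \<in> ?V"
        consider "u \<in> A" "v \<in> A" | "u \<in> A" "v \<in> N" | "u \<in> N" "v \<in> A" | "u \<in> N" "v \<in> N"
          using uv NW by blast
        then show "{u, v} \<in> ?E \<longleftrightarrow> u \<noteq> v \<and> (u \<in> A \<or> v \<in> A \<or> c u \<noteq> c v)"
        proof cases
          case 1
          then show ?thesis using cliquesD(4)[OF Acl, of u v] loop[of u] by auto
        next
          case 2
          then show ?thesis by (auto simp: N_def)
        next
          case 3
          then show ?thesis by (auto simp: N_def insert_commute)
        next
          case 4
          then show ?thesis using multi indep[of u v] loop[of u] NW by (cases "u = v") auto
        qed
      qed
    qed
    with cardN Np pt show ?thesis by simp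
  qed
  then show "card (cliques (a + s) G) \<le> (\<Prod>j<s. ?t j)"
    and "card (cliques (a + s) G) = (\<Prod>j<s. ?t j) \<Longrightarrow> graph_iso G (core_turan_graph a s m)"
    by blast+
qed

section \<open>Comparison with the extremal graph\<close>

text \<open>Without a common core the family of \<open>k\<close>-cliques has lower order in \<open>n\<close> than the number of
  \<open>k\<close>-cliques of the extremal graph, and largeness of \<open>q\<close> absorbs the constants.\<close>

lemma clique_spectral_radius_less_without_core:
  assumes G: "simple_graph G" and a: "a \<ge> 1" and s: "s \<ge> 1" and k: "k = a + s" "k \<ge> 3"
    and int: "\<And>S T. S \<in> cliques k G \<Longrightarrow> T \<in> cliques k G \<Longrightarrow> a \<le> card (S \<inter> T)"
    and nocore: "\<And>X. card X = a \<Longrightarrow> \<exists>T\<in>cliques k G. \<not> X \<subseteq> T"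
    and nk: "k \<le> card (verts G)" and q: "k ^ (2 * s + 2) < q" and nq: "card (verts G) \<le> k * q"
  shows "clique_spectral_radius k G ^ k < real (q ^ s) ^ (k - 1)"
proof -
  let ?n = "card (verts G)" and ?N = "card (cliques k G)"
  have fin: "finite (verts G)" using G by (simp add: simple_graph_def)
  have ne: "verts G \<noteq> {}" using nk k(2) by auto
  obtain s' where s': "s = Suc s'" using s by (cases s) auto
  have "?N \<le> (k choose a) * k * (?n choose s')"
    unfolding k(1) s'
  proof (rule card_intersecting_family_le[OF fin])
    show "S \<subseteq> verts G \<and> card S = a + Suc s'" if "S \<in> cliques (a + Suc s') G" for S
      using cliquesD(1,3)[OF that] by simp
  qed (use int nocore k(1) s' in auto)
  also have "k choose a = k choose s" using binomial_symmetric[of a k] k(1) by simp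
  also have "(k choose s) * k * (?n choose s') \<le> k ^ s * k * ?n ^ s'"
    using k nk s' by (intro mult_le_mono binomial_le_pow) auto
  also have "\<dots> \<le> k ^ s * k * (k * q) ^ s'" using nq by (intro mult_le_mono power_mono) auto
  also have "\<dots> = k ^ (2 * s) * q ^ s'" by (simp add: s' power_mult_distrib power_add mult_2 power2_eq_square)
  finally have N: "?N \<le> k ^ (2 * s) * q ^ s'" .
  have "k ^ 2 * ?N \<le> k ^ 2 * (k ^ (2 * s) * q ^ s')" using N by simp
  also have "\<dots> = k ^ (2 * s + 2) * q ^ s'" by (simp add: power_add power2_eq_square mult_ac)
  also have "\<dots> < q * q ^ s'" using q by (intro mult_strict_right_mono) auto
  finally have lt: "k ^ 2 * ?N < q ^ s" by (simp add: s')
  have "clique_spectral_radius k G ^ k \<le> real k ^ k * real ?N ^ (k - 1) * exp 1"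
    by (rule clique_spectral_radius_power_le_exp[OF fin ne]) (use k in simp)
  also have "\<dots> \<le> real k ^ k * real ?N ^ (k - 1) * real k"
    using exp_le k(2) by (intro mult_left_mono) auto
  also have "\<dots> = real k ^ (k + 1) * real ?N ^ (k - 1)" by simp
  also have "\<dots> \<le> real k ^ (2 * (k - 1)) * real ?N ^ (k - 1)"
    using k(2) by (intro mult_right_mono power_increasing) auto
  also have "\<dots> = real (k ^ 2 * ?N) ^ (k - 1)" by (simp add: power_mult power_mult_distrib)
  also have "\<dots> < real (q ^ s) ^ (k - 1)"
    using lt k(2) by (intro power_strict_mono) (auto simp del: of_nat_power of_nat_mult)
  finally show ?thesis .
qed

text \<open>Let \<open>P\<close> be the product of the part sizes and \<open>N\<close> the number of \<open>k\<close>-cliques. With or without a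
  common core, the \<open>k\<close>-th power of the radius is compared with \<open>P^(k - 1)\<close>, which the extremal graph
  reaches. Only the case of a common core allows equality, and there it forces \<open>N = P\<close>.\<close>

theorem clique_spectral_radius_le_core_turan:
  assumes G: "simple_graph G" and a: "a \<ge> 1" and s: "s \<ge> 1" and k: "k = a + s" "k \<ge> 3"
    and int: "\<And>S T. S \<in> cliques k G \<Longrightarrow> T \<in> cliques k G \<Longrightarrow> a \<le> card (S \<inter> T)"
    and nk: "k \<le> card (verts G)" and m: "m = card (verts G) - a"
    and q: "k ^ (2 * s + 2) < m div s" and nq: "card (verts G) \<le> k * (m div s)"
  shows "clique_spectral_radius k G \<le> clique_spectral_radius k (core_turan_graph a s m)"
    and "clique_spectral_radius k G = clique_spectral_radius k (core_turan_graph a s m)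
      \<longleftrightarrow> graph_iso G (core_turan_graph a s m)"
proof -
  let ?E = "core_turan_graph a s m" and ?N = "card (cliques k G)"
  define P where "P = (\<Prod>j<s. card (residue_class s m j))"
  have fin: "finite (verts G)" using G by (simp add: simple_graph_def)
  have ne: "verts G \<noteq> {}" using nk k(2) by auto
  have k2: "k \<ge> 2" using k by simp
  have "Inl 0 \<in> verts ?E" using a by (auto simp: verts_core_turan_graph)
  then have neE: "verts ?E \<noteq> {}" by blast
  have sm: "s \<le> m" using nk k(1) m by simp
  have mu0: "0 \<le> clique_spectral_radius k G" "0 \<le> clique_spectral_radius k ?E"
    using clique_spectral_radius_nonneg fin ne finite_verts_core_turan_graph neE k2 by blast+
  have PE: "real P ^ (k - 1) \<le> clique_spectral_radius k ?E ^ k"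
    unfolding P_def k(1) by (rule clique_spectral_radius_core_turan_ge[OF s a sm])
  have "(\<Prod>j<s. m div s) \<le> P"
    unfolding P_def by (intro prod_mono) (auto simp: card_residue_class)
  then have qP: "real ((m div s) ^ s) \<le> real P" by simp
  have main: "clique_spectral_radius k G ^ k \<le> real P ^ (k - 1)
      \<and> (clique_spectral_radius k G ^ k = real P ^ (k - 1) \<longrightarrow> graph_iso G ?E)"
  proof (cases "\<exists>A. card A = a \<and> (\<forall>K\<in>cliques k G. A \<subseteq> K)")
    case False
    then have "clique_spectral_radius k G ^ k < real ((m div s) ^ s) ^ (k - 1)"
      by (intro clique_spectral_radius_less_without_core[OF G a s k int _ nk q nq]) auto
    also have "\<dots> \<le> real P ^ (k - 1)" using qP by (rule power_mono) simp
    finally show ?thesis by simp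
  next
    case True
    then obtain A where A: "card A = a" and core: "\<And>K. K \<in> cliques k G \<Longrightarrow> A \<subseteq> K" by blast
    obtain x where x: "x \<in> A" using A a by fastforce
    have free: "cliques (Suc k) G = {}"
      by (rule no_larger_clique[of k G x]) (use core x k in auto)
    have le: "clique_spectral_radius k G ^ k \<le> real ?N ^ (k - 1)"
      by (rule clique_spectral_radius_power_le_card[OF fin ne k2 free])
    have NP: "?N \<le> P" and iso: "?N = P \<Longrightarrow> graph_iso G ?E"
      using card_cliques_with_core[OF G a s A _ m sm] core unfolding k(1) P_def by blast+
    have "real ?N ^ (k - 1) \<le> real P ^ (k - 1)" using NP by (intro power_mono) auto
    moreover have "?N = P" if "real P ^ (k - 1) \<le> real ?N ^ (k - 1)"
    proof (rule ccontr)
      assume "?N \<noteq> P"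
      with NP have "real ?N < real P" by simp
      then have "real ?N ^ (k - 1) < real P ^ (k - 1)" using k2 by (intro power_strict_mono) auto
      with that show False by simp
    qed
    ultimately show ?thesis using le iso by (metis order.trans order_refl)
  qed
  then have "clique_spectral_radius k G ^ k \<le> clique_spectral_radius k ?E ^ k" using PE by linarith
  then show "clique_spectral_radius k G \<le> clique_spectral_radius k ?E"
    using mu0 k2 by (subst (asm) power_mono_iff) auto
  show "clique_spectral_radius k G = clique_spectral_radius k ?E \<longleftrightarrow> graph_iso G ?E"
  proof
    assume "clique_spectral_radius k G = clique_spectral_radius k ?E"
    with main PE show "graph_iso G ?E" by (metis order.antisym)
  next
    assume iso: "graph_iso G ?E"
    show "clique_spectral_radius k G = clique_spectral_radius k ?E"
      by (rule order.antisym)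
        (use clique_spectral_radius_iso_le[OF iso fin ne k2]
          clique_spectral_radius_iso_le[OF graph_iso_sym[OF iso] finite_verts_core_turan_graph neE k2]
          in auto)
  qed
qed

text \<open>Different \<open>k\<close>-cliques cannot meet in \<open>k\<close> vertices, so there is at most one \<open>k\<close>-clique.\<close>

lemma clique_spectral_radius_le_1:
  assumes G: "simple_graph G" and k: "k \<ge> 2" "k \<le> card (verts G)"
    and int: "\<And>S T. S \<in> cliques k G \<Longrightarrow> T \<in> cliques k G \<Longrightarrow> k \<le> card (S \<inter> T)"
  shows "clique_spectral_radius k G \<le> 1"
    and "clique_spectral_radius k G = 1 \<longleftrightarrow> card (cliques k G) = 1"
proof -
  have fin: "finite (verts G)" using G by (simp add: simple_graph_def)
  have ne: "verts G \<noteq> {}" using k by auto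
  have uniq: "S = T" if "S \<in> cliques k G" "T \<in> cliques k G" for S T
  proof -
    have "S \<inter> T = S" "S \<inter> T = T"
      by (rule card_seteq; use int[OF that] cliquesD(2,3)[OF that(1)] cliquesD(2,3)[OF that(2)] in simp)+
    then show ?thesis by simp
  qed
  have mu0: "0 \<le> clique_spectral_radius k G" by (rule clique_spectral_radius_nonneg[OF fin ne k(1)])
  have "clique_spectral_radius k G \<le> 1 \<and> (clique_spectral_radius k G = 1 \<longleftrightarrow> card (cliques k G) = 1)"
  proof (cases "cliques k G = {}")
    case True
    then have "cliques (Suc k) G = {}" using k by (intro no_larger_clique) auto
    from clique_spectral_radius_power_le_card[OF fin ne k(1) this] True k
    have "clique_spectral_radius k G ^ k \<le> 0" by (simp add: zero_power)
    with mu0 have "clique_spectral_radius k G = 0"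
      by (metis order.antisym power_eq_0_iff zero_le_power)
    with True show ?thesis by simp
  next
    case False
    then obtain K where K: "K \<in> cliques k G" by blast
    then have "cliques k G = {K}" using uniq by blast
    moreover obtain x where "x \<in> K" using cliquesD(3)[OF K] k by fastforce
    ultimately have one: "card (cliques k G) = 1" and free: "cliques (Suc k) G = {}"
      using k by (auto intro!: no_larger_clique[of k G x])
    have "clique_spectral_radius k G ^ k \<le> 1"
      using clique_spectral_radius_power_le_card[OF fin ne k(1) free] one by simp
    then have "clique_spectral_radius k G \<le> 1"
      using k by (metis linorder_not_less one_less_power order.strict_trans2 zero_less_numeral)
    with clique_spectral_radius_ge_1[OF fin k(1) K] one show ?thesis by simp
  qed
  then show "clique_spectral_radius k G \<le> 1"
    and "clique_spectral_radius k G = 1 \<longleftrightarrow> card (cliques k G) = 1" by blast+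
qed

text \<open>The exponent \<open>k / a\<close> of the hypothesis on \<open>n\<close> turns \<open>k^(k / 2)\<close> into at least \<open>k^(2s)\<close>, and \<open>r^4\<close>
  supplies the remaining factor \<open>k^2\<close>.\<close>

lemma threshold_bound:
  fixes a s k r :: nat
  assumes a: "a \<ge> 1" and k: "k = a + s" and r: "r \<ge> 3" "k \<le> 2 * r - 1"
  shows "real (k ^ (2 * s + 2)) < (exp 1 * real r ^ 4 * real k powr (real k / 2)) powr (real k / real a)"
proof -
  have k1: "real k \<ge> 1" using a k by simp
  have "k \<le> r ^ 2"
  proof -
    have "2 * r \<le> r * r" using r(1) by (intro mult_le_mono1) auto
    with r(2) show ?thesis unfolding power2_eq_square by linarith
  qed
  then have "(real k) ^ 2 \<le> (real r ^ 2) ^ 2" by (intro power_mono) (simp_all flip: of_nat_power)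
  then have kr: "real k ^ 2 \<le> real r ^ 4" by (simp flip: power_mult)
  have ex: "exp 1 > (1::real)" by simp
  have r4: "1 \<le> real r ^ 4" using r(1) by (intro one_le_power) auto
  have base: "1 \<le> exp 1 * real r ^ 4" using ex r4 by (smt (verit) mult_le_cancel_left1)
  have ratio: "1 \<le> real k / real a" using a k by (simp add: field_simps)
  \<comment> \<open>The arithmetic-geometric mean inequality \<open>k^2 \<ge> 4 a s\<close> for \<open>k = a + s\<close>.\<close>
  have "4 * (real a * real s) \<le> real k ^ 2"
    using sum_squares_bound[of "real a" "real s"] by (simp add: k power2_sum)
  then have expo: "real (2 * s) \<le> real k / 2 * (real k / real a)"
    using a by (simp add: field_simps power2_eq_square)
  have "real (k ^ (2 * s + 2)) = real k ^ 2 * real k powr real (2 * s)"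
    using k1 by (subst powr_realpow) (simp_all add: power_add mult.commute power2_eq_square)
  also have "\<dots> \<le> real r ^ 4 * real k powr (real k / 2 * (real k / real a))"
    using kr k1 expo by (intro mult_mono powr_mono) auto
  also have "\<dots> < (exp 1 * real r ^ 4) * real k powr (real k / 2 * (real k / real a))"
  proof (rule mult_strict_right_mono)
    have "1 * real r ^ 4 < exp 1 * real r ^ 4" using r(1) ex by (intro mult_strict_right_mono) auto
    then show "real r ^ 4 < exp 1 * real r ^ 4" by simp
  qed (use k1 in simp)
  also have "\<dots> \<le> (exp 1 * real r ^ 4) powr (real k / real a) * real k powr (real k / 2 * (real k / real a))"
  proof (rule mult_right_mono)
    have "exp 1 * real r ^ 4 = (exp 1 * real r ^ 4) powr 1" using base by simp
    also have "\<dots> \<le> (exp 1 * real r ^ 4) powr (real k / real a)" using ratio base by (rule powr_mono)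
    finally show "exp 1 * real r ^ 4 \<le> (exp 1 * real r ^ 4) powr (real k / real a)" .
  qed simp
  also have "\<dots> = (exp 1 * real r ^ 4 * real k powr (real k / 2)) powr (real k / real a)"
    using base by (simp add: powr_mult powr_powr)
  finally show ?thesis .
qed

lemma part_size_bounds:
  fixes n a s k :: nat and B :: real
  assumes k: "k = a + s" and a: "a \<ge> 1" and s: "s \<ge> 1" and n: "real n \<ge> real s * B + real k"
    and B: "real (k ^ (2 * s + 2)) < B"
  shows "k ^ (2 * s + 2) < (n - a) div s" and "n \<le> k * ((n - a) div s)"
proof -
  let ?q = "(n - a) div s"
  have "0 \<le> real (k ^ (2 * s + 2))" by (rule of_nat_0_le_iff)
  with B have "0 \<le> B" by linarith
  then have "0 \<le> real s * B" by simp
  then have nk: "k \<le> n" using n by linarith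
  have dm: "n - a = ?q * s + (n - a) mod s" by simp
  moreover have "(n - a) mod s < s" using s by simp
  ultimately have up: "n < ?q * s + s + a" using nk k by linarith
  then have "n < ?q * s + k" using k by linarith
  then have "real n < real (?q * s + k)" by (simp only: of_nat_less_iff)
  then have "real n < real s * real ?q + real k" by (simp only: of_nat_add of_nat_mult mult.commute[of "real s"])
  then have "real s * B < real s * real ?q" using n by linarith
  then have "B < real ?q" using s by simp
  with B have "real (k ^ (2 * s + 2)) < real ?q" by simp
  then show big: "k ^ (2 * s + 2) < ?q" by (simp only: of_nat_less_iff)
  have "k \<le> k ^ (2 * s + 2)" using k a by (intro self_le_power) auto
  with big have kq: "k \<le> ?q" by linarith
  have "k * ?q = ?q * s + a * ?q" by (simp add: k algebra_simps)
  moreover have "?q \<le> a * ?q" using a by simp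
  ultimately show "n \<le> k * ?q" using up kq k by linarith
qed

theorem corollary1p8:
  fixes r k n :: nat and G :: "'a graph"
  assumes "r \<ge> 3" and "r \<le> k" and "k \<le> 2 * r - 1"
    and "real n \<ge> real (2 * r - k - 1) *
           (exp 1 * real r ^ 4 * real k powr (real k / 2)) powr (real k / real (2 * k - 2 * r + 1))
           + real k"
    and "simple_graph G" and "card (verts G) = n"
    and "free_of (disjoint_union (complete_graph r) (complete_graph r)) G"
  shows "clique_spectral_radius k G \<le> clique_spectral_radius k
           (graph_join (complete_graph (2 * k - 2 * r + 1))
              (turan_graph (2 * r - k - 1) (n - (2 * k - 2 * r + 1))))
       \<and> (k = 2 * r - 1 \<longrightarrow>
           (clique_spectral_radius k G = clique_spectral_radius k
              (graph_join (complete_graph (2 * k - 2 * r + 1))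
                 (turan_graph (2 * r - k - 1) (n - (2 * k - 2 * r + 1))))
            \<longleftrightarrow> card (cliques k G) = 1))
       \<and> (k \<le> 2 * r - 2 \<longrightarrow>
           (clique_spectral_radius k G = clique_spectral_radius k
              (graph_join (complete_graph (2 * k - 2 * r + 1))
                 (turan_graph (2 * r - k - 1) (n - (2 * k - 2 * r + 1))))
            \<longleftrightarrow> graph_iso G (graph_join (complete_graph (2 * k - 2 * r + 1))
                 (turan_graph (2 * r - k - 1) (n - (2 * k - 2 * r + 1))))))"
proof -
  define a where "a = 2 * k - 2 * r + 1"
  define s where "s = 2 * r - k - 1"
  let ?B = "(exp 1 * real r ^ 4 * real k powr (real k / 2)) powr (real k / real a)"
  have as: "k = a + s" "a \<ge> 1" using assms(1-3) by (auto simp: a_def s_def)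
  have k3: "k \<ge> 3" using assms(1,2) by simp
  have n: "real n \<ge> real s * ?B + real k" using assms(4) by (simp only: a_def s_def)
  have "0 \<le> real s * ?B" by simp
  with n have "real k \<le> real n" by linarith
  then have nk: "k \<le> card (verts G)" using assms(6) by simp
  have int: "a \<le> card (S \<inter> T)" if "S \<in> cliques k G" "T \<in> cliques k G" for S T
    using cliques_intersect[OF assms(7,2) that] assms(2) by (simp add: a_def)
  have "clique_spectral_radius k G \<le> clique_spectral_radius k (core_turan_graph a s (n - a))
    \<and> (k = 2 * r - 1 \<longrightarrow>
        (clique_spectral_radius k G = clique_spectral_radius k (core_turan_graph a s (n - a))
          \<longleftrightarrow> card (cliques k G) = 1))
    \<and> (k \<le> 2 * r - 2 \<longrightarrow>
        (clique_spectral_radius k G = clique_spectral_radius k (core_turan_graph a s (n - a))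
          \<longleftrightarrow> graph_iso G (core_turan_graph a s (n - a))))"
  proof (cases "s = 0")
    case True
    then have ak: "a = k" using as(1) by linarith
    have k2: "\<not> k \<le> 2 * r - 2" using True assms(1) unfolding s_def by linarith
    have muE: "clique_spectral_radius k (core_turan_graph a s (n - a)) = 1"
      using clique_spectral_radius_complete[of k] k3 True ak by simp
    have "clique_spectral_radius k G \<le> 1 \<and> (clique_spectral_radius k G = 1 \<longleftrightarrow> card (cliques k G) = 1)"
    proof -
      have "k \<le> card (S \<inter> T)" if "S \<in> cliques k G" "T \<in> cliques k G" for S T
        using int[OF that] ak by simp
      moreover have "k \<ge> 2" using k3 by simp
      ultimately show ?thesis using clique_spectral_radius_le_1[OF assms(5) _ nk] by blast
    qed
    with k2 show ?thesis unfolding muE by blast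
  next
    case False
    then have s: "s \<ge> 1" by simp
    have "k \<noteq> 2 * r - 1" using False unfolding s_def by linarith
    have "real (k ^ (2 * s + 2)) < ?B" by (rule threshold_bound[OF as(2,1) assms(1,3)])
    note q = part_size_bounds[OF as s n this]
    show ?thesis
      using clique_spectral_radius_le_core_turan[OF assms(5) as(2) s as(1) k3 int nk, of "n - a"] q
        assms(6) \<open>k \<noteq> 2 * r - 1\<close> by simp
  qed
  then show ?thesis unfolding core_turan_graph_def a_def s_def .
qed

end
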